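(* Assume that $\ell:=\lim_{p\to\infty}q(p)/p\in[0,1)$ exists. Let $u_\infty$ be a uniform limit of nonnegative weak solutions $u_p$ of $$-\Delta_p u_p(x)+\lambda_0(x)\,(u_p)_+^{q(p)}(x)=0\ \text{ in }\Omega,\qquad u_p=g\ \text{ on }\partial\Omega,$$ with $g\in\mathrm{Lip}(\partial\Omega)$, and let $\Omega'\Subset\Omega$. Then for any $x_0\in\partial\{u_\infty>0\}\cap\Omega'$ and any $0<r\ll1$ (i.e. for all $0<r<r_0$, for some small $r_0>0$ not depending on $x_0$), $$\sup_{B_r(x_0)}u_\infty(x)\ \ge\ (1-\ell)^{\frac1{1-\ell}}\,r^{\frac1{1-\ell}} .$$
   Context: $\Omega\subset\mathbb R^N$ is a regular bounded domain; $\lambda_0$ is a bounded function on $\Omega$ which is bounded away from zero ($0<\inf_\Omega\lambda_0\le\sup_\Omega\lambda_0<\infty$); $g\ge0$; $p\ge2$ and $0\le q(p)<p-1$; $\lambda_0$ and $g$ do not depend on $p$. $\Delta_pu=\mathrm{div}(|\nabla u|^{p-2}\nabla u)$, $u_+=\max\{u,0\}$, and $u_+^0$ means $\chi_{\{u>0\}}$. A weak solution is $u\in W^{1,p}_{\rm loc}(\Omega)$ with $\int_\Omega|\nabla u|^{p-2}\nabla u\cdot\nabla\varphi\,dx=-\int_\Omega\lambda_0u_+^q\varphi\,dx$ for all $0\le\varphi\in C_0^1(\Omega)$, with $u=g$ on $\partial\Omega$. "$u_\infty$ is a uniform limit of the $u_p$" means that there is a sequence $p_j\to\infty$ with $u_{p_j}\to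 u_\infty$ uniformly in $\overline\Omega$. *)

theory Defs
  imports "HOL-Analysis.Analysis"
begin

definition domain :: "'a::euclidean_space set \<Rightarrow> bool" where
  "domain \<Omega> \<longleftrightarrow> open \<Omega> \<and> connected \<Omega> \<and> \<Omega> \<noteq> {}"

text \<open>
  A regular domain is read as one with Lipschitz boundary: near every boundary point,
  \<open>\<Omega>\<close> is the strict epigraph, in some unit direction \<open>e\<close>, of a Lipschitz function of the
  component of \<open>x\<close> orthogonal to \<open>e\<close>.
\<close>

definition lipschitz_boundary :: "'a::euclidean_space set \<Rightarrow> bool" where
  "lipschitz_boundary \<Omega> \<longleftrightarrow>
    (\<forall>z \<in> frontier \<Omega>. \<exists>U e L \<gamma>. open U \<and> z \<in> U \<and> norm e = 1 \<and> L-lipschitz_on UNIV \<gamma> \<and>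
       \<Omega> \<inter> U = {x \<in> U. x \<bullet> e > (\<gamma> (x - (x \<bullet> e) *\<^sub>R e) :: real)})"

definition regular_bounded_domain :: "'a::euclidean_space set \<Rightarrow> bool" where
  "regular_bounded_domain \<Omega> \<longleftrightarrow> domain \<Omega> \<and> bounded \<Omega> \<and> lipschitz_boundary \<Omega>"

definition compactly_contained :: "'a::euclidean_space set \<Rightarrow> 'a set \<Rightarrow> bool"
    (infix \<open>\<Subset>\<close> 50) where
  "A \<Subset> \<Omega> \<longleftrightarrow> compact (closure A) \<and> closure A \<subseteq> \<Omega>"

text \<open>
  \<open>C01 \<Omega> \<phi> D\<phi>\<close>: \<open>\<phi>\<close>, extended by zero to the whole space, is a \<open>C\<^sup>1\<close> function with compact
  support in \<open>\<Omega>\<close>, and \<open>D\<phi>\<close> is its gradient.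
\<close>

definition C01 :: "'a::euclidean_space set \<Rightarrow> ('a \<Rightarrow> real) \<Rightarrow> ('a \<Rightarrow> 'a) \<Rightarrow> bool" where
  "C01 \<Omega> \<phi> D\<phi> \<longleftrightarrow>
    (\<forall>x. GDERIV \<phi> x :> D\<phi> x) \<and> continuous_on UNIV D\<phi> \<and> {x. \<phi> x \<noteq> 0} \<Subset> \<Omega>"

definition Lp_loc ::
    "real \<Rightarrow> 'a::euclidean_space set \<Rightarrow> ('a \<Rightarrow> 'b::euclidean_space) \<Rightarrow> bool" where
  "Lp_loc p \<Omega> f \<longleftrightarrow> f \<in> borel_measurable (lebesgue_on \<Omega>) \<and>
    (\<forall>K. compact K \<and> K \<subseteq> \<Omega> \<longrightarrow> integrable (lebesgue_on K) (\<lambda>x. norm (f x) powr p))"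

text \<open>
  The weak gradient, tested against \<open>C\<^sup>1\<close> functions of compact support. The vector-valued
  identity collects the identities for the individual partial derivatives.
\<close>

definition weak_gradient ::
    "'a::euclidean_space set \<Rightarrow> ('a \<Rightarrow> real) \<Rightarrow> ('a \<Rightarrow> 'a) \<Rightarrow> bool" where
  "weak_gradient \<Omega> u Du \<longleftrightarrow>
    (\<forall>\<phi> D\<phi>. C01 \<Omega> \<phi> D\<phi> \<longrightarrow>
       (\<integral>x. u x *\<^sub>R D\<phi> x \<partial>lebesgue_on \<Omega>) = - (\<integral>x. \<phi> x *\<^sub>R Du x \<partial>lebesgue_on \<Omega>))"

text \<open>\<open>W1p_loc p \<Omega> u Du\<close>: \<open>u \<in> W\<^sup>1\<^sup>,\<^sup>p\<^sub>l\<^sub>o\<^sub>c(\<Omega>)\<close> with weak gradient \<open>Du\<close>.\<close>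

definition W1p_loc ::
    "real \<Rightarrow> 'a::euclidean_space set \<Rightarrow> ('a \<Rightarrow> real) \<Rightarrow> ('a \<Rightarrow> 'a) \<Rightarrow> bool" where
  "W1p_loc p \<Omega> u Du \<longleftrightarrow> Lp_loc p \<Omega> u \<and> Lp_loc p \<Omega> Du \<and> weak_gradient \<Omega> u Du"

text \<open>
  Weak solutions of \<open>- \<Delta>\<^sub>p u + lam u\<^sub>+\<^sup>q = 0\<close> in \<open>\<Omega>\<close>, \<open>u = g\<close> on \<open>\<partial>\<Omega>\<close>. Since \<open>u\<close> is only in
  \<open>W\<^sup>1\<^sup>,\<^sup>p\<^sub>l\<^sub>o\<^sub>c(\<Omega>)\<close>, the boundary condition is understood classically, for the representative of
  \<open>u\<close> that is continuous up to the boundary; uniform convergence on the closure and the set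
  \<open>{u > 0}\<close> refer to this representative as well.

  As \<open>0 powr a = 0\<close> for all \<open>a\<close>, the term \<open>max (u x) 0 powr q\<close> is the characteristic function
  of \<open>{u > 0}\<close> for \<open>q = 0\<close>, and for \<open>p = 2\<close> the value of \<open>norm (Du x) powr (p - 2)\<close> where
  \<open>Du x = 0\<close> is irrelevant.
\<close>

definition weak_solution ::
    "real \<Rightarrow> real \<Rightarrow> ('a::euclidean_space \<Rightarrow> real) \<Rightarrow> ('a \<Rightarrow> real) \<Rightarrow> 'a set \<Rightarrow> ('a \<Rightarrow> real) \<Rightarrow> bool"
  where
  "weak_solution p q lam g \<Omega> u \<longleftrightarrow>
    (\<exists>Du. W1p_loc p \<Omega> u Du \<and>
      (\<forall>\<phi> D\<phi>. C01 \<Omega> \<phi> D\<phi> \<and> (\<forall>x. 0 \<le> \<phi> x) \<longrightarrow>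
        (\<integral>x. norm (Du x) powr (p - 2) * (Du x \<bullet> D\<phi> x) \<partial>lebesgue_on \<Omega>)
          = - (\<integral>x. lam x * max (u x) 0 powr q * \<phi> x \<partial>lebesgue_on \<Omega>))) \<and>
    continuous_on (closure \<Omega>) u \<and> (\<forall>x \<in> frontier \<Omega>. u x = g x)"

end

theory Submission
  imports Defs
begin

text \<open>
  The estimate is the limit of a nondegeneracy estimate for each finite \<open>p\<close>. Let \<open>u\<close> be a
  nonnegative weak solution for exponents \<open>p\<close> and \<open>q\<close>, and put \<open>\<alpha> = p / (p - 1 - q)\<close>. The radial
  function \<open>v x = c * norm (x - a) powr \<alpha>\<close> has \<open>p\<close>-Laplacian a constant times
  \<open>norm (x - a) powr (\<alpha> * q)\<close>, which is a multiple of \<open>v powr q\<close>; for a suitable \<open>c\<close> it is a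
  supersolution, even with the coefficient replaced by half of its infimum. If \<open>u a > 0 = v a\<close>,
  then \<open>u\<close> cannot stay below \<open>v\<close> on the sphere of radius \<open>r\<close> about \<open>a\<close>: otherwise \<open>u \<le> v\<close>
  inside by comparison. Hence \<open>u \<ge> c * r powr \<alpha>\<close> somewhere on the sphere
  (\<open>weak_solution_nondegenerate\<close>). As \<open>p\<close> tends to infinity, \<open>\<alpha>\<close> tends to \<open>1 / (1 - l)\<close> and \<open>c\<close>
  to \<open>(1 - l) powr (1 / (1 - l))\<close> (\<open>barrier_limits\<close>), since bounded factors and powers of \<open>p\<close>
  disappear under a root of order \<open>p - 1 - q\<close>. Positivity at points near the free boundary
  passes from \<open>uinf\<close> to \<open>u (p j)\<close> by uniform convergence, and the estimate passes back to \<open>uinf\<close>.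

  The comparison has to be made for weak solutions whose gradient is only in \<open>L\<^sup>p\<^sub>l\<^sub>o\<^sub>c\<close>, whereas
  test functions are \<open>C\<^sup>1\<close>. The test function is the square of the positive part of \<open>ue - v\<close>,
  where \<open>ue\<close> is a mollification of \<open>u\<close>; the square makes it \<open>C\<^sup>1\<close>, and it is still a
  nondecreasing function of \<open>ue - v\<close>. Its gradient is \<open>2 * max (ue - v) 0\<close> times \<open>Due - Dv\<close>, and
  \<open>Due = (Due - Du) + Du\<close>. With \<open>Du - Dv\<close> in place of \<open>Due - Dv\<close> the difference of the fluxes
  \<open>norm Du powr (p - 2) *\<^sub>R Du\<close> and \<open>norm Dv powr (p - 2) *\<^sub>R Dv\<close> pairs nonnegatively
  (\<open>powr_flux_monotone\<close>), and the error is at most a multiple of the integral of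
  \<open>(norm Du powr (p - 1) + C) * norm (Due - Du)\<close>, where \<open>C\<close> bounds the flux of \<open>v\<close>. By
  Tonelli this is at most an average over small translations \<open>h\<close> of the integrals of \<open>(norm Du powr (p - 1) + C) * norm (Du (x + h) - Du x)\<close>,
  which tend to zero by continuity of translations
  (\<open>weighted_translation_continuous\<close>, \<open>weighted_mollification_error\<close>). The resulting
  comparison up to an error is \<open>weak_solution_approximate_comparison\<close>.
  The halved coefficient of the barrier gives a strict inequality that absorbs the errors,
  also for \<open>q = 0\<close>.
\<close>

section \<open>Powers, positive parts and gradients\<close>

lemma positive_part_square_deriv:
  "((\<lambda>t::real. (max t 0)\<^sup>2) has_real_derivative 2 * max t 0) (at t)"
proof -
  have key: "\<bar>(max y 0)\<^sup>2 - (max t 0)\<^sup>2 - 2 * max t 0 * (y - t)\<bar> \<le> (y - t)\<^sup>2" for y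
  proof (cases "y \<ge> 0"; cases "t \<ge> 0")
    assume a: "y \<ge> 0" "t \<ge> 0"
    have "y\<^sup>2 - t\<^sup>2 - 2 * t * (y - t) = (y - t)\<^sup>2" by (simp add: power2_eq_square algebra_simps)
    then show ?thesis using a by simp
  next
    assume a: "y \<ge> 0" "\<not> t \<ge> 0"
    then have "y \<le> y - t" by simp
    then have "y\<^sup>2 \<le> (y - t)\<^sup>2" using a by (intro power_mono) auto
    then show ?thesis using a by simp
  next
    assume a: "\<not> y \<ge> 0" "t \<ge> 0"
    then have "t * y \<le> 0" by (simp add: mult_nonneg_nonpos)
    moreover have "(y - t)\<^sup>2 = y\<^sup>2 - 2 * (t * y) + t\<^sup>2" by (simp add: power2_eq_square algebra_simps)
    moreover have "(max y 0)\<^sup>2 - (max t 0)\<^sup>2 - 2 * max t 0 * (y - t) = t\<^sup>2 - 2 * (t * y)"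
      using a by (simp add: power2_eq_square algebra_simps)
    ultimately show ?thesis by (smt (verit) zero_le_power2)
  next
    assume "\<not> y \<ge> 0" "\<not> t \<ge> 0" then show ?thesis by simp
  qed
  have "((\<lambda>y. ((max y 0)\<^sup>2 - (max t 0)\<^sup>2) / (y - t) - 2 * max t 0) \<longlongrightarrow> 0) (at t)"
  proof (rule Lim_null_comparison)
    show "\<forall>\<^sub>F y in at t. norm (((max y 0)\<^sup>2 - (max t 0)\<^sup>2) / (y - t) - 2 * max t 0) \<le> \<bar>y - t\<bar>"
    proof (rule eventually_at_topological[THEN iffD2], intro exI[of _ UNIV], safe)
      fix y :: real assume "y \<noteq> t"
      then have "((max y 0)\<^sup>2 - (max t 0)\<^sup>2) / (y - t) - 2 * max t 0
          = ((max y 0)\<^sup>2 - (max t 0)\<^sup>2 - 2 * max t 0 * (y - t)) / (y - t)"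
        by (simp add: diff_divide_distrib)
      also have "\<bar>\<dots>\<bar> \<le> (y - t)\<^sup>2 / \<bar>y - t\<bar>"
        using key[of y] by (simp add: abs_divide divide_right_mono)
      also have "\<dots> = \<bar>y - t\<bar>" using \<open>y \<noteq> t\<close>
        by (metis abs_eq_0 eq_iff_diff_eq_0 nonzero_mult_div_cancel_right power2_abs power2_eq_square)
      finally show "norm (((max y 0)\<^sup>2 - (max t 0)\<^sup>2) / (y - t) - 2 * max t 0) \<le> \<bar>y - t\<bar>" by simp
    qed auto
    show "((\<lambda>y. \<bar>y - t\<bar>) \<longlongrightarrow> 0) (at t)"
      by (rule tendsto_eq_intros refl | simp)+
  qed
  then show ?thesis
    unfolding has_field_derivative_iff by (simp add: LIM_zero_iff)
qed

lemma GDERIV_continuous_on: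
  assumes "\<And>x. GDERIV f x :> Df x"
  shows "continuous_on UNIV f"
  using assms has_derivative_continuous unfolding gderiv_def
  by (blast intro: continuous_at_imp_continuous_on)

lemma GDERIV_eq_0_on_open:
  assumes "GDERIV f x :> D" "open S" "x \<in> S" "\<And>y. y \<in> S \<Longrightarrow> f y = 0"
  shows "D = 0"
proof -
  have "(f has_derivative (\<lambda>h. 0)) (at x)"
    by (rule has_derivative_transform_within_open[OF has_derivative_const[of 0] assms(2,3)])
       (simp add: assms(4))
  with assms(1) have "(\<lambda>h. h \<bullet> D) = (\<lambda>h. 0)"
    unfolding gderiv_def by (rule has_derivative_unique)
  then have "D \<bullet> D = 0" by metis
  then show ?thesis by simp
qed

text \<open>
  Monotonicity of the flux of the \<open>p\<close>-Laplacian, with \<open>s = p - 2\<close>. By Cauchy-Schwarz it reduces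
  to the monotonicity of \<open>t powr s * t\<close> in \<open>t = norm a\<close>.
\<close>

lemma powr_flux_monotone:
  fixes a b :: "'a::real_inner"
  assumes "0 \<le> s"
  shows "0 \<le> (norm a powr s *\<^sub>R a - norm b powr s *\<^sub>R b) \<bullet> (a - b)"
proof -
  let ?A = "norm a powr s" and ?B = "norm b powr s"
  have "0 \<le> (?A * norm a - ?B * norm b) * (norm a - norm b)"
  proof (cases "norm a \<le> norm b")
    case True
    then have "?A \<le> ?B" using assms by (intro powr_mono2) auto
    then have "?A * norm a \<le> ?B * norm b" using True by (intro mult_mono) auto
    then show ?thesis using True by (simp add: mult_nonpos_nonpos)
  next
    case False
    then have "?B \<le> ?A" using assms by (intro powr_mono2) auto
    then have "?B * norm b \<le> ?A * norm a" using False by (intro mult_mono) auto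
    then show ?thesis using False by simp
  qed
  also have "\<dots> = ?A * (norm a)\<^sup>2 + ?B * (norm b)\<^sup>2 - (?A + ?B) * (norm a * norm b)"
    by (simp add: power2_eq_square algebra_simps)
  also have "\<dots> \<le> ?A * (norm a)\<^sup>2 + ?B * (norm b)\<^sup>2 - (?A + ?B) * (a \<bullet> b)"
    using norm_cauchy_schwarz[of a b] by (intro diff_left_mono mult_left_mono) auto
  also have "\<dots> = (?A *\<^sub>R a - ?B *\<^sub>R b) \<bullet> (a - b)"
    by (simp add: inner_diff_left inner_diff_right dot_square_norm inner_commute algebra_simps)
  finally show ?thesis .
qed

lemma GDERIV_norm_powr:
  fixes y :: "'a::real_inner"
  assumes "1 < \<alpha>"
  shows "GDERIV (\<lambda>y. norm y powr \<alpha>) y :> (\<alpha> * norm y powr (\<alpha> - 2)) *\<^sub>R y"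
proof (cases "y = 0")
  case False
  have "((\<lambda>t. t powr \<alpha>) has_real_derivative \<alpha> * norm y powr (\<alpha> - 1)) (at (norm y))"
    using False by (intro has_real_derivative_powr) auto
  from GDERIV_DERIV_compose[OF GDERIV_norm[OF False] this]
  have "GDERIV (\<lambda>y. norm y powr \<alpha>) y :> (\<alpha> * norm y powr (\<alpha> - 1)) *\<^sub>R sgn y" .
  moreover have "norm y powr (\<alpha> - 1) / norm y = norm y powr (\<alpha> - 2)"
    using False by (simp add: powr_diff power2_eq_square)
  ultimately show ?thesis
    by (simp add: sgn_div_norm divide_inverse mult.assoc)
next
  case True
  have "((\<lambda>h. norm h powr (\<alpha> - 1)) \<longlongrightarrow> 0) (at (0::'a))"
    using assms by (auto intro!: tendsto_eq_intros)
  moreover have "norm h powr (\<alpha> - 1) = norm h powr \<alpha> / norm h" if "h \<noteq> 0" for h :: 'a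
    using that by (simp add: powr_diff)
  ultimately have "((\<lambda>h. norm h powr \<alpha> / norm h) \<longlongrightarrow> 0) (at (0::'a))"
    by (auto elim!: Lim_transform_eventually simp: eventually_at_filter)
  then show ?thesis
    using True by (simp add: gderiv_def has_derivative_at)
qed

lemma continuous_norm_powr_scaleR:
  assumes "-1 < s"
  shows "continuous_on UNIV (\<lambda>y::'a::real_normed_vector. norm y powr s *\<^sub>R y)"
proof (rule continuous_at_imp_continuous_on, safe)
  fix y :: 'a
  show "isCont (\<lambda>y::'a. norm y powr s *\<^sub>R y) y"
  proof (cases "y = 0")
    case True
    have "((\<lambda>h::'a. norm h powr (s + 1)) \<longlongrightarrow> 0) (at 0)"
      using assms by (auto intro!: tendsto_eq_intros)
    moreover have "norm (norm h powr s *\<^sub>R h) = norm h powr (s + 1)" for h :: 'a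
      by (cases "h = 0") (auto simp: powr_add)
    ultimately have "((\<lambda>h::'a. norm (norm h powr s *\<^sub>R h)) \<longlongrightarrow> 0) (at 0)"
      by (simp only:)
    then have "((\<lambda>h::'a. norm h powr s *\<^sub>R h) \<longlongrightarrow> 0) (at 0)"
      by (rule tendsto_norm_zero_cancel)
    then show ?thesis using True by (simp add: isCont_def)
  next
    case False
    then show ?thesis by (intro continuous_intros) auto
  qed
qed

section \<open>Divergence of homogeneous radial fields\<close>

text \<open>
  A bridge to the gauge integral over a box, where the differentiations under the integral
  sign below are carried out.
\<close>

lemma integral_lborel_continuous_cbox:
  fixes f :: "'a::euclidean_space \<Rightarrow> 'b::euclidean_space"
  assumes "continuous_on UNIV f" "\<And>x. x \<notin> cbox a b \<Longrightarrow> f x = 0"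
  shows "integrable lborel f" "integral\<^sup>L lborel f = integral (cbox a b) f"
proof -
  have eq: "(\<lambda>x. indicator (cbox a b) x *\<^sub>R f x) = f"
    using assms(2) by (auto simp: indicator_def)
  have "integrable lborel (\<lambda>x. indicator (cbox a b) x *\<^sub>R f x)"
    using assms(1) by (intro borel_integrable_compact) (auto intro: continuous_on_subset)
  then show int: "integrable lborel f" by (simp only: eq)
  have "integral (cbox a b) f = integral UNIV (\<lambda>x. if x \<in> cbox a b then f x else 0)"
    by (rule integral_restrict_UNIV[symmetric])
  also have "(\<lambda>x. if x \<in> cbox a b then f x else 0) = f" using assms(2) by auto
  finally show "integral\<^sup>L lborel f = integral (cbox a b) f"
    using integral_lborel[OF int] by simp
qed

lemma integrable_lborel_continuous_support:
  fixes f :: "'a::euclidean_space \<Rightarrow> 'b::euclidean_space"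
  assumes "continuous_on UNIV f" "bounded {x. f x \<noteq> 0}"
  shows "integrable lborel f"
proof -
  obtain a where "{x. f x \<noteq> 0} \<subseteq> cbox (-a) a"
    using bounded_subset_cbox_symmetric[OF assms(2)] by blast
  then show ?thesis
    using integral_lborel_continuous_cbox(1)[OF assms(1), of "-a" a] by blast
qed

lemma integral_lborel_dilation:
  fixes f :: "'a::euclidean_space \<Rightarrow> real"
  assumes "t > 0" and [measurable]: "f \<in> borel_measurable borel"
  shows "(\<integral>x. f (a + t *\<^sub>R x) \<partial>lborel) = (1 / t ^ DIM('a)) * (\<integral>x. f x \<partial>lborel)"
proof -
  have "(\<integral>x. f x \<partial>lborel) = (\<integral>x. f x \<partial>density (distr lborel borel (\<lambda>x. a + t *\<^sub>R x)) (\<lambda>_. \<bar>t\<bar>^DIM('a)))"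
    using lborel_affine[of t a] assms(1) by simp
  also have "\<dots> = (\<integral>x. \<bar>t\<bar>^DIM('a) *\<^sub>R f x \<partial>distr lborel borel (\<lambda>x. a + t *\<^sub>R x))"
    by (subst integral_density) auto
  also have "\<dots> = (\<integral>x. \<bar>t\<bar>^DIM('a) *\<^sub>R f (a + t *\<^sub>R x) \<partial>lborel)"
    by (subst integral_distr) auto
  also have "\<dots> = t ^ DIM('a) * (\<integral>x. f (a + t *\<^sub>R x) \<partial>lborel)"
    using assms(1) by simp
  finally show ?thesis using assms(1) by simp
qed

text \<open>
  For \<open>k\<close> homogeneous of degree \<open>m\<close> the field \<open>k y *\<^sub>R y\<close> has divergence
  \<open>(DIM('a) + m) * k y\<close> by Euler's relation, and this is the corresponding integration by parts.
  As \<open>k\<close> may fail to be differentiable, for instance a small power of the norm at the origin,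
  the formula is derived from scaling: the integral of \<open>k (x - a) * \<phi> (a + t *\<^sub>R (x - a))\<close> is
  \<open>t powr - (DIM('a) + m)\<close> times its value at \<open>t = 1\<close>, and both sides are differentiated at
  \<open>t = 1\<close>.
\<close>

lemma homogeneous_field_divergence_theorem:
  fixes \<phi> k :: "'a::euclidean_space \<Rightarrow> real" and m :: real
  assumes grad: "\<And>x. GDERIV \<phi> x :> D\<phi> x" and contD: "continuous_on UNIV D\<phi>"
    and supp: "bounded {x. \<phi> x \<noteq> 0}"
    and contk: "continuous_on UNIV k" and hom: "\<And>t y. t > 0 \<Longrightarrow> k (t *\<^sub>R y) = t powr m * k y"
  shows "(\<integral>x. k (x - a) * ((x - a) \<bullet> D\<phi> x) \<partial>lborel)
    = - (DIM('a) + m) * (\<integral>x. k (x - a) * \<phi> x \<partial>lborel)"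
proof -
  have cont\<phi>: "continuous_on UNIV \<phi>"
    using grad by (rule GDERIV_continuous_on)
  note [continuous_intros] = continuous_on_compose2[OF cont\<phi>] continuous_on_compose2[OF contD]
    continuous_on_compose2[OF contk]
  have [measurable]: "\<phi> \<in> borel_measurable borel" "D\<phi> \<in> borel_measurable borel"
    "k \<in> borel_measurable borel"
    using cont\<phi> contD contk by (auto intro: borel_measurable_continuous_onI)
  obtain R where R: "R > 0" "\<And>x. \<phi> (a + x) \<noteq> 0 \<Longrightarrow> norm x < R"
  proof -
    obtain R where "R > 0" "{x. \<phi> x \<noteq> 0} \<subseteq> ball a R"
      using bounded_subset_ballD[OF supp] by blast
    then show ?thesis by (intro that[of R]) (auto simp: dist_norm subset_iff)
  qed
  have zero: "\<phi> x = 0 \<and> D\<phi> x = 0" if "norm (x - a) > R" for x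
  proof -
    let ?S = "{y. R < norm (y - a)}"
    have "open ?S" by (intro open_Collect_less continuous_intros)
    moreover have "\<phi> y = 0" if "y \<in> ?S" for y
      using R(2)[of "y - a"] that by fastforce
    moreover have "x \<in> ?S" using that by simp
    ultimately show ?thesis
      using GDERIV_eq_0_on_open[OF grad[of x], of ?S] by blast
  qed
  let ?I = "\<lambda>t. (\<integral>x. k (x - a) * \<phi> (a + t *\<^sub>R (x - a)) \<partial>lborel)"
  obtain b where b: "cball a (2 * R) \<subseteq> cbox (-b) b"
    using bounded_subset_cbox_symmetric[OF bounded_cball] by blast
  have out: "\<phi> (a + t *\<^sub>R (x - a)) = 0 \<and> D\<phi> (a + t *\<^sub>R (x - a)) = 0"
    if "x \<notin> cbox (-b) b" "t \<ge> 1/2" for t x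
  proof -
    have "x \<notin> cball a (2 * R)" using b that by blast
    then have "norm (x - a) > 2 * R" by (simp add: dist_norm norm_minus_commute)
    moreover have "(1/2) * norm (x - a) \<le> t * norm (x - a)"
      using that by (intro mult_right_mono) auto
    then have "(1/2) * norm (x - a) \<le> norm (t *\<^sub>R (x - a))"
      using that by simp
    ultimately show ?thesis using zero[of "a + t *\<^sub>R (x - a)"] by simp
  qed
  \<comment> \<open>Substituting \<open>y = a + t *\<^sub>R (x - a)\<close> puts the dependence on \<open>t\<close> into a power.\<close>
  have scale: "?I t = t powr (- (DIM('a) + m)) * ?I 1" if "t > 0" for t
  proof -
    define f where "f = (\<lambda>y. k ((1/t) *\<^sub>R (y - a)) * \<phi> y)"
    have [measurable]: "f \<in> borel_measurable borel" unfolding f_def by measurable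
    have "?I t = (\<integral>x. f ((a - t *\<^sub>R a) + t *\<^sub>R x) \<partial>lborel)"
      using that by (intro Bochner_Integration.integral_cong) (auto simp: f_def algebra_simps)
    also have "\<dots> = (1 / t ^ DIM('a)) * (\<integral>x. f x \<partial>lborel)"
      by (rule integral_lborel_dilation[OF that]) simp
    also have "(\<integral>x. f x \<partial>lborel) = (\<integral>x. (1/t) powr m * (k (x - a) * \<phi> x) \<partial>lborel)"
      unfolding f_def by (subst hom) (use that in \<open>auto simp: mult.assoc\<close>)
    also have "\<dots> = (1/t) powr m * (\<integral>x. k (x - a) * \<phi> x \<partial>lborel)" by simp
    finally show ?thesis
      using that by (simp add: powr_add powr_minus powr_realpow powr_divide powr_minus_divide field_simps powr_diff)
  qed
  \<comment> \<open>For \<open>t \<ge> 1/2\<close> all integrands live in one box, so the parameter derivative goes inside.\<close>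
  let ?J = "\<lambda>t. integral (cbox (-b) b) (\<lambda>x. k (x - a) * \<phi> (a + t *\<^sub>R (x - a)))"
  have IJ: "?I t = ?J t" if "t \<ge> 1/2" for t
    using out that by (intro integral_lborel_continuous_cbox) (auto intro!: continuous_intros)
  have "(?J has_field_derivative
      integral (cbox (-b) b) (\<lambda>x. k (x - a) * ((x - a) \<bullet> D\<phi> (a + 1 *\<^sub>R (x - a))))) (at 1 within {1/2<..})"
  proof (rule leibniz_rule_field_derivative)
    fix t x
    have "GDERIV \<phi> (a + t *\<^sub>R (x - a)) :> D\<phi> (a + t *\<^sub>R (x - a))" by (rule grad)
    then have "((\<lambda>t. \<phi> (a + t *\<^sub>R (x - a))) has_derivative (\<lambda>h. (h *\<^sub>R (x - a)) \<bullet> D\<phi> (a + t *\<^sub>R (x - a)))) (at t within {1/2<..})"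
      unfolding gderiv_def
      by (rule has_derivative_compose[rotated]) (auto intro!: derivative_eq_intros)
    then have "((\<lambda>t. \<phi> (a + t *\<^sub>R (x - a))) has_field_derivative (x - a) \<bullet> D\<phi> (a + t *\<^sub>R (x - a))) (at t within {1/2<..})"
      unfolding has_field_derivative_def by (simp add: mult_commute_abs)
    then show "((\<lambda>t. k (x - a) * \<phi> (a + t *\<^sub>R (x - a))) has_field_derivative k (x - a) * ((x - a) \<bullet> D\<phi> (a + t *\<^sub>R (x - a)))) (at t within {1/2<..})"
      by (rule DERIV_cmult)
  next
    fix t :: real
    show "(\<lambda>x. k (x - a) * \<phi> (a + t *\<^sub>R (x - a))) integrable_on cbox (-b) b"
      by (intro integrable_continuous continuous_intros) auto
  next
    show "continuous_on ({1/2<..} \<times> cbox (-b) b) (\<lambda>(t, x). k (x - a) * ((x - a) \<bullet> D\<phi> (a + t *\<^sub>R (x - a))))"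
      unfolding case_prod_beta by (intro continuous_intros) auto
  qed auto
  then have "(?J has_field_derivative
      integral (cbox (-b) b) (\<lambda>x. k (x - a) * ((x - a) \<bullet> D\<phi> x))) (at 1)"
    by (simp add: at_within_open[of _ "{1/2<..}"])
  also have "integral (cbox (-b) b) (\<lambda>x. k (x - a) * ((x - a) \<bullet> D\<phi> x)) = (\<integral>x. k (x - a) * ((x - a) \<bullet> D\<phi> x) \<partial>lborel)"
    using out[where t=1] by (intro integral_lborel_continuous_cbox(2)[symmetric]) (auto intro!: continuous_intros)
  finally have D1: "(?J has_field_derivative (\<integral>x. k (x - a) * ((x - a) \<bullet> D\<phi> x) \<partial>lborel)) (at 1)" .
  have "((\<lambda>t. t powr (- (DIM('a) + m)) * ?I 1) has_field_derivative (- (DIM('a) + m)) * ?I 1) (at 1)"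
    by (auto intro!: derivative_eq_intros)
  then have D2: "(?J has_field_derivative (- (DIM('a) + m)) * ?I 1) (at 1)"
  proof (rule DERIV_cong_ev[THEN iffD1, rotated -1])
    show "\<forall>\<^sub>F t in nhds 1. t powr (- (DIM('a) + m)) * ?I 1 = ?J t"
    proof (rule eventually_mono)
      show "\<forall>\<^sub>F t in nhds 1. t > (1/2::real)" by (rule order_tendstoD) (auto intro!: filterlim_ident)
    qed (use scale IJ in auto)
  qed auto
  show ?thesis using DERIV_unique[OF D1 D2] by simp
qed

section \<open>Mollification\<close>

definition mollifier :: "real \<Rightarrow> ('a::euclidean_space \<Rightarrow> real) \<Rightarrow> ('a \<Rightarrow> 'a) \<Rightarrow> bool" where
  "mollifier \<epsilon> \<eta> D\<eta> \<longleftrightarrow> (\<forall>z. GDERIV \<eta> z :> D\<eta> z) \<and> continuous_on UNIV D\<eta> \<and>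
     (\<forall>z. 0 \<le> \<eta> z) \<and> (\<forall>z. \<epsilon> \<le> norm z \<longrightarrow> \<eta> z = 0) \<and>
     (\<forall>z. \<eta> (- z) = \<eta> z) \<and> (\<integral>z. \<eta> z \<partial>lborel) = 1"

text \<open>
  Test functions are only \<open>C\<^sup>1\<close>, so the normalised polynomial bump with profile
  \<open>(max (\<epsilon>\<^sup>2 - z \<bullet> z) 0)\<^sup>2\<close> is smooth enough.
\<close>

lemma mollifier_exists:
  assumes "0 < \<epsilon>"
  shows "\<exists>\<eta> D\<eta>. mollifier \<epsilon> (\<eta> :: 'a::euclidean_space \<Rightarrow> real) D\<eta>"
proof -
  define b where "b = (\<lambda>z::'a. (max (\<epsilon>\<^sup>2 - z \<bullet> z) 0)\<^sup>2)"
  define Db where "Db = (\<lambda>z::'a. (2 * max (\<epsilon>\<^sup>2 - z \<bullet> z) 0) *\<^sub>R (- 2 *\<^sub>R z))"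
  define c where "c = (\<integral>z. b z \<partial>lborel)"
  have grad: "GDERIV b z :> Db z" for z
  proof -
    have "GDERIV (\<lambda>z::'a. \<epsilon>\<^sup>2 - z \<bullet> z) z :> - 2 *\<^sub>R z"
      unfolding gderiv_def by (auto intro!: derivative_eq_intros simp: inner_commute)
    from GDERIV_DERIV_compose[OF this positive_part_square_deriv] show ?thesis
      by (simp add: b_def Db_def)
  qed
  have contD: "continuous_on UNIV Db" unfolding Db_def by (intro continuous_intros)
  have cont: "continuous_on UNIV b" unfolding b_def by (intro continuous_intros)
  have zero: "b z = 0" if "\<epsilon> \<le> norm z" for z
  proof -
    have "\<epsilon>\<^sup>2 \<le> (norm z)\<^sup>2" using that assms by (intro power_mono) auto
    then show ?thesis by (simp add: b_def dot_square_norm)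
  qed
  have int: "integrable lborel b"
  proof (rule integrable_lborel_continuous_support[OF cont])
    have "{x. b x \<noteq> 0} \<subseteq> ball 0 \<epsilon>" using zero by force
    then show "bounded {x. b x \<noteq> 0}" using bounded_ball bounded_subset by blast
  qed
  have nn: "0 \<le> b z" for z by (simp add: b_def)
  have "c > 0"
  proof -
    have "c \<noteq> 0"
    proof
      assume "c = 0"
      then have "AE z in lborel. b z = 0"
        using integral_nonneg_eq_0_iff_AE[OF int] nn by (simp add: c_def)
      then have "AE z in lborel. (z::'a) \<notin> ball 0 \<epsilon>"
      proof eventually_elim
        case (elim z)
        show ?case
        proof
          assume "z \<in> ball 0 \<epsilon>"
          then have "(norm z)\<^sup>2 < \<epsilon>\<^sup>2" by (intro power_strict_mono) auto
          then show False using elim by (simp add: b_def dot_square_norm)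
        qed
      qed
      then have "ball (0::'a) \<epsilon> \<in> null_sets lborel"
        by (subst (asm) AE_iff_null_sets[symmetric]) auto
      then have "emeasure lborel (ball (0::'a) \<epsilon>) = 0" by auto
      moreover have "emeasure lborel (ball (0::'a) \<epsilon>) \<noteq> 0"
      proof -
        have "\<not> negligible (ball (0::'a) \<epsilon>)" using assms by (intro open_not_negligible) auto
        then show ?thesis
          by (simp add: negligible_iff_emeasure0)
      qed
      ultimately show False by simp
    qed
    moreover have "c \<ge> 0" unfolding c_def using nn by (simp add: integral_nonneg_AE)
    ultimately show ?thesis by simp
  qed
  have "mollifier \<epsilon> (\<lambda>z. b z / c) (\<lambda>z. (1 / c) *\<^sub>R Db z)"
    unfolding mollifier_def
  proof (intro conjI allI impI)
    fix z
    show "GDERIV (\<lambda>z. b z / c) z :> (1 / c) *\<^sub>R Db z"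
      using has_derivative_mult_right[OF grad[of z, unfolded gderiv_def], of "1 / c"]
      by (simp add: gderiv_def)
    show "continuous_on UNIV (\<lambda>z. (1 / c) *\<^sub>R Db z)" using contD by (intro continuous_intros)
    show "(\<integral>z. b z / c \<partial>lborel) = 1" using \<open>c > 0\<close> by (simp add: c_def)
  qed (use \<open>c > 0\<close> nn zero in \<open>auto simp: b_def\<close>)
  then show ?thesis by blast
qed

text \<open>
  The derivative falls on the kernel, which is why the mollified function is \<open>C\<^sup>1\<close>. Locally
  in \<open>x\<close> the integrals extend over a fixed box.
\<close>

lemma convolution_GDERIV:
  fixes \<eta> U :: "'a::euclidean_space \<Rightarrow> real"
  assumes moll: "mollifier \<epsilon> \<eta> D\<eta>" and contU: "continuous_on UNIV U"
  shows "GDERIV (\<lambda>x. \<integral>y. \<eta> (x - y) * U y \<partial>lborel) x :> (\<integral>y. U y *\<^sub>R D\<eta> (x - y) \<partial>lborel)" (is ?g)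
    and "isCont (\<lambda>x. \<integral>y. U y *\<^sub>R D\<eta> (x - y) \<partial>lborel) x" (is ?c)
proof -
  have grad: "\<And>z. GDERIV \<eta> z :> D\<eta> z" and contD: "continuous_on UNIV D\<eta>"
    and zero: "\<And>z. \<epsilon> \<le> norm z \<Longrightarrow> \<eta> z = 0"
    using moll by (auto simp: mollifier_def)
  have cont\<eta>: "continuous_on UNIV \<eta>" using grad by (rule GDERIV_continuous_on)
  note [continuous_intros] = continuous_on_compose2[OF cont\<eta>] continuous_on_compose2[OF contD]
    continuous_on_compose2[OF contU]
  have zeroD: "D\<eta> z = 0" if "\<epsilon> < norm z" for z
    by (rule GDERIV_eq_0_on_open[OF grad, of "{z. \<epsilon> < norm z}"])
       (use that zero in \<open>auto intro!: open_Collect_less continuous_intros\<close>)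
  obtain b where b: "cball x (2 + \<bar>\<epsilon>\<bar>) \<subseteq> cbox (-b) b"
    using bounded_subset_cbox_symmetric[OF bounded_cball] by blast
  have out: "\<eta> (z - y) = 0 \<and> D\<eta> (z - y) = 0" if "z \<in> ball x 1" "y \<notin> cbox (-b) b" for z y
  proof -
    have "y \<notin> cball x (2 + \<bar>\<epsilon>\<bar>)" using that b by blast
    then have "2 + \<bar>\<epsilon>\<bar> < dist x y" by simp
    also have "\<dots> \<le> dist x z + dist z y" by (rule dist_triangle)
    finally have "\<epsilon> < norm (z - y)" using that by (auto simp: dist_norm)
    then show ?thesis using zero zeroD by simp
  qed
  have e1: "(\<integral>y. \<eta> (z - y) * U y \<partial>lborel) = integral (cbox (-b) b) (\<lambda>y. \<eta> (z - y) * U y)"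
    if "z \<in> ball x 1" for z
    using out[OF that] by (intro integral_lborel_continuous_cbox) (auto intro!: continuous_intros)
  have e2: "(\<integral>y. U y *\<^sub>R D\<eta> (z - y) \<partial>lborel) = integral (cbox (-b) b) (\<lambda>y. U y *\<^sub>R D\<eta> (z - y))"
    if "z \<in> ball x 1" for z
    using out[OF that] by (intro integral_lborel_continuous_cbox) (auto intro!: continuous_intros)
  have "((\<lambda>z. integral (cbox (-b) b) (\<lambda>y. \<eta> (z - y) * U y)) has_derivative
      blinfun_apply (integral (cbox (-b) b) (\<lambda>y. blinfun_inner_left (U y *\<^sub>R D\<eta> (x - y))))) (at x within ball x 1)"
  proof (rule leibniz_rule)
    fix z y
    have "((\<lambda>z. \<eta> (z - y)) has_derivative (\<lambda>h. h \<bullet> D\<eta> (z - y))) (at z within ball x 1)"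
      using grad[of "z - y"] unfolding gderiv_def
      by (rule has_derivative_compose[rotated]) (auto intro!: derivative_eq_intros)
    then show "((\<lambda>z. \<eta> (z - y) * U y) has_derivative blinfun_apply (blinfun_inner_left (U y *\<^sub>R D\<eta> (z - y)))) (at z within ball x 1)"
      by (auto intro!: derivative_eq_intros simp: mult.commute)
  next
    fix z
    show "(\<lambda>y. \<eta> (z - y) * U y) integrable_on cbox (-b) b"
      by (intro integrable_continuous continuous_intros) auto
  next
    show "continuous_on (ball x 1 \<times> cbox (-b) b) (\<lambda>(z, y). blinfun_inner_left (U y *\<^sub>R D\<eta> (z - y)))"
      unfolding case_prod_beta
      by (intro bounded_linear.continuous_on[OF bounded_linear_blinfun_inner_left] continuous_intros) auto
  qed auto
  also have "integral (cbox (-b) b) (\<lambda>y. blinfun_inner_left (U y *\<^sub>R D\<eta> (x - y)))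
      = blinfun_inner_left (integral (cbox (-b) b) (\<lambda>y. U y *\<^sub>R D\<eta> (x - y)))"
    by (rule integral_linear[OF _ bounded_linear_blinfun_inner_left, unfolded o_def])
       (intro integrable_continuous continuous_intros, auto)
  finally have "((\<lambda>z. integral (cbox (-b) b) (\<lambda>y. \<eta> (z - y) * U y)) has_derivative
      (\<lambda>h. h \<bullet> integral (cbox (-b) b) (\<lambda>y. U y *\<^sub>R D\<eta> (x - y)))) (at x)"
    by (simp add: at_within_open[of _ "ball x 1"])
  then show ?g
    unfolding gderiv_def e2[of x, simplified]
    by (rule has_derivative_transform_within_open[of _ _ _ _ "ball x 1"]) (use e1 in auto)
  have "continuous_on (ball x 1) (\<lambda>z. integral (cbox (-b) b) (\<lambda>y. U y *\<^sub>R D\<eta> (z - y)))"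
    by (rule integral_continuous_on_param) (auto simp: case_prod_beta intro!: continuous_intros)
  then have "continuous_on (ball x 1) (\<lambda>z. \<integral>y. U y *\<^sub>R D\<eta> (z - y) \<partial>lborel)"
    by (rule continuous_on_cong[THEN iffD1, rotated -1]) (use e2 in auto)
  then show ?c
    by (rule continuous_on_interior) auto
qed

lemma mollification_pointwise_error:
  fixes \<eta> U :: "'a::euclidean_space \<Rightarrow> real"
  assumes moll: "mollifier \<epsilon> \<eta> D\<eta>" and contU: "continuous_on UNIV U"
    and near: "\<And>y. norm (x - y) < \<epsilon> \<Longrightarrow> \<bar>U y - U x\<bar> \<le> \<sigma>"
  shows "\<bar>(\<integral>y. \<eta> (x - y) * U y \<partial>lborel) - U x\<bar> \<le> \<sigma>"
proof -
  have grad: "\<And>z. GDERIV \<eta> z :> D\<eta> z" and nn: "\<And>z. 0 \<le> \<eta> z"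
    and zero: "\<And>z. \<epsilon> \<le> norm z \<Longrightarrow> \<eta> z = 0" and even: "\<And>z. \<eta> (- z) = \<eta> z"
    and one: "(\<integral>z. \<eta> z \<partial>lborel) = 1"
    using moll by (auto simp: mollifier_def)
  have cont\<eta>: "continuous_on UNIV \<eta>" using grad by (rule GDERIV_continuous_on)
  note [continuous_intros] = continuous_on_compose2[OF cont\<eta>] continuous_on_compose2[OF contU]
  have bd: "bounded {y. \<eta> (x - y) * W y \<noteq> 0}" for W
  proof -
    have "{y. \<eta> (x - y) * W y \<noteq> 0} \<subseteq> ball x \<epsilon>" using zero by (force simp: dist_norm)
    then show ?thesis using bounded_ball bounded_subset by blast
  qed
  have i1: "integrable lborel (\<lambda>y. \<eta> (x - y) * U y)"
    by (intro integrable_lborel_continuous_support bd) (auto intro!: continuous_intros)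
  have i2: "integrable lborel (\<lambda>y. \<eta> (x - y) * c)" for c
    by (intro integrable_lborel_continuous_support bd) (auto intro!: continuous_intros)
  have [measurable]: "\<eta> \<in> borel_measurable borel" using cont\<eta> by (rule borel_measurable_continuous_onI)
  have "(\<integral>y. \<eta> (x - y) \<partial>lborel) = (\<integral>y. \<eta> (- x + 1 *\<^sub>R y) \<partial>lborel)"
    by (metis even minus_diff_eq scaleR_one uminus_add_conv_diff)
  also have "\<dots> = 1" using integral_lborel_dilation[of 1 \<eta> "-x"] one by simp
  finally have one': "(\<integral>y. \<eta> (x - y) \<partial>lborel) = 1" .
  have "(\<integral>y. \<eta> (x - y) * U y \<partial>lborel) - U x = (\<integral>y. \<eta> (x - y) * U y - \<eta> (x - y) * U x \<partial>lborel)"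
    using i1 i2 one' by simp
  also have "\<bar>\<dots>\<bar> \<le> (\<integral>y. \<bar>\<eta> (x - y) * U y - \<eta> (x - y) * U x\<bar> \<partial>lborel)"
    by (rule integral_abs_bound)
  also have "\<dots> \<le> (\<integral>y. \<eta> (x - y) * \<sigma> \<partial>lborel)"
  proof (intro integral_mono i2 integrable_abs Bochner_Integration.integrable_diff i1)
    fix y
    have "\<bar>\<eta> (x - y) * U y - \<eta> (x - y) * U x\<bar> = \<eta> (x - y) * \<bar>U y - U x\<bar>"
      using nn[of "x - y"] by (simp add: abs_mult flip: right_diff_distrib)
    also have "\<dots> \<le> \<eta> (x - y) * \<sigma>"
      using near[of y] nn[of "x - y"] zero[of "x - y"] by (cases "norm (x - y) < \<epsilon>") (auto intro: mult_left_mono)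
    finally show "\<bar>\<eta> (x - y) * U y - \<eta> (x - y) * U x\<bar> \<le> \<eta> (x - y) * \<sigma>" .
  qed
  also have "\<dots> = \<sigma>" using one' by simp
  finally show ?thesis .
qed

section \<open>Continuity of translations\<close>

lemma nn_integral_lborel_shift:
  fixes h :: "'a::euclidean_space"
  assumes [measurable]: "f \<in> borel_measurable borel"
  shows "(\<integral>\<^sup>+x. f (x + h) \<partial>lborel) = (\<integral>\<^sup>+x. f x \<partial>lborel)"
proof -
  have "(\<integral>\<^sup>+x. f x \<partial>lborel) = (\<integral>\<^sup>+x. f x \<partial>distr lborel borel ((+) h))"
    by (simp add: lborel_distr_plus)
  also have "\<dots> = (\<integral>\<^sup>+x. f (x + h) \<partial>lborel)"
    by (subst nn_integral_distr) (auto simp: add.commute)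
  finally show ?thesis by simp
qed

text \<open>
  Stated with the nonnegative integral, so that the bound carries the integrability of the
  difference with it.
\<close>

definition L1_translation_continuous :: "('a::euclidean_space \<Rightarrow> 'b::euclidean_space) \<Rightarrow> bool" where
  "L1_translation_continuous F \<longleftrightarrow>
    (\<forall>e>0. \<exists>d>0. \<forall>h. norm h < d \<longrightarrow> (\<integral>\<^sup>+x. norm (F (x + h) - F x) \<partial>lborel) \<le> ennreal e)"

text \<open>
  A point that leaves \<open>U\<close> under a translation by \<open>h\<close> is within \<open>norm h\<close> of the complement,
  and the points of \<open>U\<close> that are that close decrease to the empty set.
\<close>

lemma open_minus_translate_small:
  fixes U :: "'a::euclidean_space set"
  assumes U: "open U" and fin: "emeasure lborel U < \<infinity>" and "0 < (e::real)"
  shows "\<exists>d>0. \<forall>h. norm h < d \<longrightarrow> emeasure lborel {x \<in> U. x + h \<notin> U} \<le> ennreal e"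
proof -
  have [measurable]: "U \<in> sets borel" using U by auto
  have ne: "- U \<noteq> {}"
  proof
    assume "- U = {}"
    then have "U = UNIV" by blast
    then show False using fin by simp
  qed
  define E where "E = (\<lambda>n. {x \<in> U. infdist x (- U) < 1 / Suc n})"
  have "open (E n)" for n
  proof -
    have "open (U \<inter> {x. infdist x (- U) < 1 / Suc n})"
      by (intro open_Int U open_Collect_less continuous_intros)
    then show ?thesis by (simp add: E_def Collect_conj_eq)
  qed
  then have E_borel [measurable]: "E n \<in> sets borel" for n by auto
  have "(\<lambda>n. emeasure lborel (E n)) \<longlonglongrightarrow> emeasure lborel (\<Inter>n. E n)"
  proof (rule Lim_emeasure_decseq)
    show "decseq E"
      unfolding decseq_def E_def
      by (auto simp: frac_le intro: order.strict_trans2)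
    show "emeasure lborel (E n) \<noteq> \<infinity>" for n
    proof -
      have "emeasure lborel (E n) \<le> emeasure lborel U" by (rule emeasure_mono) (auto simp: E_def)
      then show ?thesis using fin by (auto simp: top_unique)
    qed
  qed (use E_borel in auto)
  moreover have "(\<Inter>n. E n) = {}"
  proof (rule ccontr)
    assume "(\<Inter>n. E n) \<noteq> {}"
    then obtain x where x: "x \<in> U" "\<And>n. infdist x (- U) < 1 / Suc n" by (auto simp: E_def)
    have "infdist x (- U) > 0"
      using x(1) U ne by (intro infdist_pos_not_in_closed) auto
    then obtain n where "inverse (of_nat (Suc n)) < infdist x (- U)" using reals_Archimedean by blast
    then show False using x(2)[of n] by (simp add: inverse_eq_divide)
  qed
  ultimately have "(\<lambda>n. emeasure lborel (E n)) \<longlonglongrightarrow> 0" by simp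
  then have "\<forall>\<^sub>F n in sequentially. emeasure lborel (E n) < ennreal e"
    using \<open>0 < e\<close> by (intro order_tendstoD(2)) auto
  then obtain n where n: "emeasure lborel (E n) < ennreal e" by (auto simp: eventually_sequentially)
  show ?thesis
  proof (intro exI[of _ "1 / Suc n"] conjI allI impI)
    fix h :: 'a assume h: "norm h < 1 / Suc n"
    have "{x \<in> U. x + h \<notin> U} \<subseteq> E n"
    proof
      fix x assume "x \<in> {x \<in> U. x + h \<notin> U}"
      then have "infdist x (- U) \<le> dist x (x + h)" "x \<in> U" by (auto intro: infdist_le)
      then show "x \<in> E n" using h by (auto simp: E_def dist_norm)
    qed
    then have "emeasure lborel {x \<in> U. x + h \<notin> U} \<le> emeasure lborel (E n)"
      by (intro emeasure_mono) auto
    then show "emeasure lborel {x \<in> U. x + h \<notin> U} \<le> ennreal e" using n by simp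
  qed auto
qed

text \<open>
  Outer regularity reduces the claim to open sets: if \<open>x\<close> and \<open>x + h\<close> are separated by \<open>A\<close>, then
  they are separated by \<open>U\<close> or one of them lies in the small set \<open>U - A\<close>.
\<close>

lemma L1_translation_continuous_indicator:
  fixes A :: "'a::euclidean_space set" and c :: "'b::euclidean_space"
  assumes A: "A \<in> sets borel" and fin: "emeasure lborel A < \<infinity>"
  shows "L1_translation_continuous (\<lambda>x. indicator A x *\<^sub>R c)"
  unfolding L1_translation_continuous_def
proof (intro allI impI)
  fix e :: real assume "e > 0"
  define e' where "e' = e / (4 * (norm c + 1))"
  have c1: "norm c + 1 > 0" by (simp add: add_nonneg_pos)
  have e': "e' > 0" using \<open>e > 0\<close> c1 by (simp add: e'_def)
  obtain U where U: "open U" "A \<subseteq> U" and UA: "emeasure lborel (U - A) \<le> e'"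
    using outer_regular_lborel_le[OF A e'] by blast
  have [measurable]: "U \<in> sets borel" "A \<in> sets borel" using U A by auto
  have "emeasure lborel U \<le> emeasure lborel A + emeasure lborel (U - A)"
    using emeasure_subadditive[of A lborel "U - A"] U(2) by (simp add: Un_absorb1)
  also have "\<dots> < \<infinity>" using fin UA by (simp add: order_le_less_trans)
  finally have Ufin: "emeasure lborel U < \<infinity>" .
  obtain d where d: "d > 0" "\<And>h. norm h < d \<Longrightarrow> emeasure lborel {x \<in> U. x + h \<notin> U} \<le> ennreal e'"
    using open_minus_translate_small[OF U(1) Ufin e'] by blast
  show "\<exists>d>0. \<forall>h. norm h < d \<longrightarrow>
      (\<integral>\<^sup>+x. norm (indicator A (x + h) *\<^sub>R c - indicator A x *\<^sub>R c) \<partial>lborel) \<le> ennreal e"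
  proof (intro exI[of _ d] conjI allI impI)
    fix h :: 'a assume h: "norm h < d"
    have [measurable]: "{x \<in> U. x + h \<notin> U} \<in> sets borel" "{x \<in> U. x - h \<notin> U} \<in> sets borel" for h
      by measurable
    have "(\<integral>\<^sup>+x. norm (indicator A (x + h) *\<^sub>R c - indicator A x *\<^sub>R c) \<partial>lborel)
      \<le> (\<integral>\<^sup>+x. ennreal (norm c + 1) * ((indicator (U - A) (x + h) + indicator (U - A) x)
          + (indicator {x \<in> U. x + h \<notin> U} x + indicator {x \<in> U. x - h \<notin> U} (x + h))) \<partial>lborel)"
    proof (rule nn_integral_mono)
      fix x
      show "ennreal (norm (indicator A (x + h) *\<^sub>R c - indicator A x *\<^sub>R c)) \<le>
        ennreal (norm c + 1) * ((indicator (U - A) (x + h) + indicator (U - A) x)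
          + (indicator {x \<in> U. x + h \<notin> U} x + indicator {x \<in> U. x - h \<notin> U} (x + h)))"
        using U(2) by (auto simp: indicator_def ennreal_leI mult_ge1_I split: if_splits)
    qed
    also have "\<dots> = ennreal (norm c + 1) * ((\<integral>\<^sup>+x. indicator (U - A) (x + h) \<partial>lborel) + (\<integral>\<^sup>+x. indicator (U - A) x \<partial>lborel)
          + ((\<integral>\<^sup>+x. indicator {x \<in> U. x + h \<notin> U} x \<partial>lborel) + (\<integral>\<^sup>+x. indicator {x \<in> U. x - h \<notin> U} (x + h) \<partial>lborel)))"
      by (simp add: nn_integral_cmult nn_integral_add)
    also have "\<dots> = ennreal (norm c + 1) * (emeasure lborel (U - A) + emeasure lborel (U - A)
          + (emeasure lborel {x \<in> U. x + h \<notin> U} + emeasure lborel {x \<in> U. x - h \<notin> U}))"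
      by (subst (1 2) nn_integral_lborel_shift) auto
    also have "\<dots> \<le> ennreal (norm c + 1) * (ennreal e' + ennreal e' + (ennreal e' + ennreal e'))"
      using d(2)[OF h] d(2)[of "-h"] h UA by (intro mult_left_mono add_mono) auto
    also have "\<dots> = ennreal ((norm c + 1) * (4 * e'))"
    proof -
      have "ennreal e' + ennreal e' + (ennreal e' + ennreal e') = ennreal (e' + e' + (e' + e'))"
        using e' by (simp only: ennreal_plus add_nonneg_nonneg less_imp_le)
      also have "e' + e' + (e' + e') = 4 * e'" by simp
      finally show ?thesis using c1 by (simp only: ennreal_mult' less_imp_le)
    qed
    also have "(norm c + 1) * (4 * e') = e" using c1 by (simp add: e'_def divide_simps)
    finally show "(\<integral>\<^sup>+x. norm (indicator A (x + h) *\<^sub>R c - indicator A x *\<^sub>R c) \<partial>lborel) \<le> ennreal e" .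
  qed (use d in auto)
qed

lemma integrable_imp_L1_translation_continuous:
  fixes F :: "'a::euclidean_space \<Rightarrow> 'b::euclidean_space"
  assumes "integrable lborel F"
  shows "L1_translation_continuous F"
  using assms
proof (induction rule: integrable_induct)
  case (base A c)
  then show ?case by (intro L1_translation_continuous_indicator) auto
next
  case (add f g)
  have [measurable]: "f \<in> borel_measurable borel" "g \<in> borel_measurable borel"
    using add.hyps by (auto dest!: borel_measurable_integrable)
  show ?case
    unfolding L1_translation_continuous_def
  proof (intro allI impI)
    fix e :: real assume "e > 0"
    then have e2: "e / 2 > 0" by simp
    obtain d1 where d1: "d1 > 0" "\<And>h. norm h < d1 \<Longrightarrow> (\<integral>\<^sup>+x. norm (f (x + h) - f x) \<partial>lborel) \<le> ennreal (e/2)"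
      using add.IH(1) e2 unfolding L1_translation_continuous_def by blast
    obtain d2 where d2: "d2 > 0" "\<And>h. norm h < d2 \<Longrightarrow> (\<integral>\<^sup>+x. norm (g (x + h) - g x) \<partial>lborel) \<le> ennreal (e/2)"
      using add.IH(2) e2 unfolding L1_translation_continuous_def by blast
    show "\<exists>d>0. \<forall>h. norm h < d \<longrightarrow> (\<integral>\<^sup>+x. norm (f (x + h) + g (x + h) - (f x + g x)) \<partial>lborel) \<le> ennreal e"
    proof (intro exI[of _ "min d1 d2"] conjI allI impI)
      fix h :: 'a assume h: "norm h < min d1 d2"
      have "(\<integral>\<^sup>+x. norm (f (x + h) + g (x + h) - (f x + g x)) \<partial>lborel)
        \<le> (\<integral>\<^sup>+x. ennreal (norm (f (x + h) - f x)) + ennreal (norm (g (x + h) - g x)) \<partial>lborel)"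
        by (intro nn_integral_mono) (auto simp: norm_diff_triangle_ineq simp flip: ennreal_plus intro!: ennreal_leI)
      also have "\<dots> = (\<integral>\<^sup>+x. norm (f (x + h) - f x) \<partial>lborel) + (\<integral>\<^sup>+x. norm (g (x + h) - g x) \<partial>lborel)"
        by (rule nn_integral_add) auto
      also have "\<dots> \<le> ennreal (e/2) + ennreal (e/2)"
        using d1(2)[of h] d2(2)[of h] h by (intro add_mono) auto
      also have "\<dots> = ennreal e" using \<open>e > 0\<close> by (simp flip: ennreal_plus)
      finally show "(\<integral>\<^sup>+x. norm (f (x + h) + g (x + h) - (f x + g x)) \<partial>lborel) \<le> ennreal e" .
    qed (use d1 d2 in auto)
  qed
next
  case (lim f s)
  have [measurable]: "f \<in> borel_measurable borel" "s i \<in> borel_measurable borel" for i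
    using lim.hyps(1)[of i] lim.hyps(4) by (auto dest!: borel_measurable_integrable)
  have conv: "(\<lambda>i. \<integral>\<^sup>+x. norm (f x - s i x) \<partial>lborel) \<longlonglongrightarrow> 0"
  proof (rule nn_integral_dominated_convergence_norm)
    show "(\<integral>\<^sup>+x. ennreal (2 * norm (f x)) \<partial>lborel) < \<infinity>"
      using lim.hyps(4)
      by (auto simp: integrable_iff_bounded ennreal_mult nn_integral_cmult ennreal_mult_less_top)
  qed (use lim.hyps(2,3) in auto)
  show ?case
    unfolding L1_translation_continuous_def
  proof (intro allI impI)
    fix e :: real assume "e > 0"
    then have e3: "e / 3 > 0" by simp
    have "\<forall>\<^sub>F i in sequentially. (\<integral>\<^sup>+x. norm (f x - s i x) \<partial>lborel) < ennreal (e/3)"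
      using conv e3 by (intro order_tendstoD(2)) auto
    then obtain i where i: "(\<integral>\<^sup>+x. norm (f x - s i x) \<partial>lborel) < ennreal (e/3)"
      by (auto simp: eventually_sequentially)
    obtain d where d: "d > 0" "\<And>h. norm h < d \<Longrightarrow> (\<integral>\<^sup>+x. norm (s i (x + h) - s i x) \<partial>lborel) \<le> ennreal (e/3)"
      using lim.IH[of i] e3 unfolding L1_translation_continuous_def by blast
    show "\<exists>d>0. \<forall>h. norm h < d \<longrightarrow> (\<integral>\<^sup>+x. norm (f (x + h) - f x) \<partial>lborel) \<le> ennreal e"
    proof (intro exI[of _ d] conjI allI impI)
      fix h :: 'a assume h: "norm h < d"
      have "(\<integral>\<^sup>+x. norm (f (x + h) - f x) \<partial>lborel)
        \<le> (\<integral>\<^sup>+x. (ennreal (norm (f (x + h) - s i (x + h))) + ennreal (norm (s i (x + h) - s i x)))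
              + ennreal (norm (f x - s i x)) \<partial>lborel)"
      proof (intro nn_integral_mono)
        fix x
        have "norm (f (x + h) - f x) \<le> norm (f (x + h) - s i (x + h)) + norm (s i (x + h) - s i x) + norm (f x - s i x)"
          by norm
        then show "ennreal (norm (f (x + h) - f x)) \<le> (ennreal (norm (f (x + h) - s i (x + h))) + ennreal (norm (s i (x + h) - s i x)))
              + ennreal (norm (f x - s i x))"
          by (simp flip: ennreal_plus add: ennreal_leI)
      qed
      also have "\<dots> = (\<integral>\<^sup>+x. norm (f (x + h) - s i (x + h)) \<partial>lborel) + (\<integral>\<^sup>+x. norm (s i (x + h) - s i x) \<partial>lborel)
          + (\<integral>\<^sup>+x. norm (f x - s i x) \<partial>lborel)"
        by (simp add: nn_integral_add)
      also have "(\<integral>\<^sup>+x. norm (f (x + h) - s i (x + h)) \<partial>lborel) = (\<integral>\<^sup>+x. norm (f x - s i x) \<partial>lborel)"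
        by (rule nn_integral_lborel_shift) measurable
      also have "(\<integral>\<^sup>+x. norm (f x - s i x) \<partial>lborel) + (\<integral>\<^sup>+x. norm (s i (x + h) - s i x) \<partial>lborel) + (\<integral>\<^sup>+x. norm (f x - s i x) \<partial>lborel)
          \<le> ennreal (e/3) + ennreal (e/3) + ennreal (e/3)"
        using d(2)[OF h] i by (intro add_mono) auto
      also have "\<dots> = ennreal e" using \<open>e > 0\<close> by (simp flip: ennreal_plus)
      finally show "(\<integral>\<^sup>+x. norm (f (x + h) - f x) \<partial>lborel) \<le> ennreal e" .
    qed (use d in auto)
  qed
qed

text \<open>
  A crude form of Young's inequality, from the alternative \<open>b \<le> a / \<delta>\<close> or \<open>a < \<delta> * b\<close>. It
  separates the two factors in the estimate of the high values of \<open>F\<close> below.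
\<close>

lemma powr_Young_small:
  fixes a b \<delta> s :: real
  assumes "0 \<le> a" "0 \<le> b" "0 < \<delta>" "\<delta> \<le> 1" "2 \<le> s"
  shows "a powr (s - 1) * b \<le> a powr s / \<delta> + \<delta> * b powr s"
proof (cases "b \<le> a / \<delta>")
  case True
  have "a powr (s - 1) * b \<le> a powr (s - 1) * (a / \<delta>)" using True by (intro mult_left_mono) auto
  also have "\<dots> = a powr s / \<delta>"
    using assms by (cases "a = 0") (auto simp: powr_diff)
  finally show ?thesis using assms by (simp add: add_increasing2)
next
  case False
  then have "a \<le> \<delta> * b" using assms by (simp add: field_simps)
  then have "a powr (s - 1) \<le> (\<delta> * b) powr (s - 1)" using assms by (intro powr_mono2) auto
  also have "\<dots> = \<delta> powr (s - 1) * b powr (s - 1)" using assms by (simp add: powr_mult)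
  also have "\<dots> \<le> \<delta> powr 1 * b powr (s - 1)"
    using assms by (intro mult_right_mono powr_mono') auto
  finally have "a powr (s - 1) * b \<le> \<delta> * b powr (s - 1) * b"
    using assms by (simp add: mult_right_mono)
  also have "\<dots> = \<delta> * b powr s" using assms by (cases "b = 0") (auto simp: powr_diff)
  finally show ?thesis using assms by (simp add: add_increasing)
qed

text \<open>
  Where \<open>norm (F x)\<close> is at most a large \<open>n\<close> the weight is bounded, and continuity of
  translations in \<open>L\<^sup>1\<close> applies. Where it exceeds \<open>n\<close>, \<open>powr_Young_small\<close> bounds the integrand
  by a large multiple of \<open>norm (F x) powr s\<close>, whose integral over that set is small by dominated
  convergence, and a small multiple of \<open>norm (F (x + h)) powr s\<close>, whose integral does not
  depend on \<open>h\<close>.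
\<close>

lemma weighted_translation_continuous:
  fixes F :: "'a::euclidean_space \<Rightarrow> 'b::euclidean_space"
  assumes s: "2 \<le> s" and F: "integrable lborel F" and Fs: "integrable lborel (\<lambda>x. norm (F x) powr s)"
    and "0 < e" and "0 \<le> C"
  shows "\<exists>d>0. \<forall>h. norm h < d \<longrightarrow>
    (\<integral>\<^sup>+x. (norm (F x) powr (s - 1) + C) * norm (F (x + h) - F x) \<partial>lborel) \<le> ennreal e"
proof -
  have [measurable]: "F \<in> borel_measurable borel"
    using F by (auto dest!: borel_measurable_integrable)
  define I where "I = (\<integral>x. norm (F x) powr s \<partial>lborel)"
  have I: "(\<integral>\<^sup>+x. norm (F x) powr s \<partial>lborel) = ennreal I" "0 \<le> I"
    unfolding I_def by (auto intro: nn_integral_eq_integral[OF Fs])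
  \<comment> \<open>Each of the three terms of the final bound is to be at most \<open>e / 3\<close>.\<close>
  define \<delta> where "\<delta> = min 1 (e / (3 * (I + 1)))"
  have \<delta>: "0 < \<delta>" "\<delta> \<le> 1" using \<open>0 < e\<close> I(2) by (auto simp: \<delta>_def)
  have \<delta>I: "\<delta> * I \<le> e / 3"
  proof -
    have "\<delta> * I \<le> e / (3 * (I + 1)) * I" using I(2) by (intro mult_right_mono) (auto simp: \<delta>_def)
    also have "\<dots> \<le> e / 3" using I(2) \<open>0 < e\<close> by (simp add: field_simps)
    finally show ?thesis .
  qed
  define T where "T = (\<lambda>(n::nat) x. if norm (F x) > n then norm (F x) powr s else 0)"
  have [measurable]: "T n \<in> borel_measurable borel" for n unfolding T_def by measurable
  have "(\<lambda>n. \<integral>\<^sup>+x. norm (0 - T n x) \<partial>lborel) \<longlonglongrightarrow> 0"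
  proof (rule nn_integral_dominated_convergence_norm)
    show "(\<integral>\<^sup>+x. ennreal (norm (F x) powr s) \<partial>lborel) < \<infinity>" by (simp add: I)
    show "AE x in lborel. (\<lambda>n. T n x) \<longlonglongrightarrow> 0"
    proof (rule AE_I2, rule tendsto_eventually)
      fix x
      obtain N :: nat where "norm (F x) \<le> N" using real_arch_simple by blast
      then show "\<forall>\<^sub>F n in sequentially. T n x = 0"
        by (intro eventually_sequentiallyI[of N]) (auto simp: T_def)
    qed
  qed (auto simp: T_def)
  then have "\<forall>\<^sub>F n in sequentially. (\<integral>\<^sup>+x. norm (0 - T n x) \<partial>lborel) < ennreal (\<delta> * e / 6)"
    using \<delta> \<open>0 < e\<close> by (intro order_tendstoD(2)) auto
  then obtain n where n: "(\<integral>\<^sup>+x. norm (0 - T n x) \<partial>lborel) < ennreal (\<delta> * e / 6)"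
    by (auto simp: eventually_sequentially)
  define M where "M = real n powr (s - 1) + C"
  have M: "0 \<le> M" using \<open>0 \<le> C\<close> by (simp add: M_def)
  have "L1_translation_continuous F" by (rule integrable_imp_L1_translation_continuous[OF F])
  then obtain d where d: "d > 0" "\<And>h. norm h < d \<Longrightarrow> (\<integral>\<^sup>+x. norm (F (x + h) - F x) \<partial>lborel) \<le> ennreal (e / (3 * (M + 1)))"
    unfolding L1_translation_continuous_def using \<open>0 < e\<close> M
    by (metis add_nonneg_pos divide_pos_pos mult_pos_pos zero_less_numeral zero_less_one)
  show ?thesis
  proof (intro exI[of _ d] conjI allI impI)
    fix h :: 'a assume h: "norm h < d"
    have pw: "(norm (F x) powr (s - 1) + C) * norm (F (x + h) - F x)
      \<le> M * norm (F (x + h) - F x) + ((2 / \<delta>) * T n x + \<delta> * norm (F (x + h)) powr s)" for x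
    proof (cases "norm (F x) > n")
      case False
      then have "norm (F x) powr (s - 1) \<le> real n powr (s - 1)" using s by (intro powr_mono2) auto
      then have "(norm (F x) powr (s - 1) + C) * norm (F (x + h) - F x) \<le> M * norm (F (x + h) - F x)"
        by (intro mult_right_mono) (auto simp: M_def)
      moreover have "0 \<le> (2 / \<delta>) * T n x + \<delta> * norm (F (x + h)) powr s" using \<delta> by (simp add: T_def)
      ultimately show ?thesis by simp
    next
      case True
      have "norm (F x) powr (s - 1) * norm (F (x + h) - F x) \<le> norm (F x) powr (s - 1) * (norm (F (x + h)) + norm (F x))"
        by (intro mult_left_mono norm_triangle_ineq4) auto
      also have "\<dots> = norm (F x) powr (s - 1) * norm (F (x + h)) + norm (F x) powr s"
        using s by (cases "F x = 0") (auto simp: distrib_left powr_diff)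
      also have "\<dots> \<le> (norm (F x) powr s / \<delta> + \<delta> * norm (F (x + h)) powr s) + norm (F x) powr s / \<delta>"
        using \<delta> s by (intro add_mono powr_Young_small) (auto simp: le_divide_eq mult_left_le)
      also have "\<dots> = (2 / \<delta>) * T n x + \<delta> * norm (F (x + h)) powr s"
        using True by (simp add: T_def)
      finally have "norm (F x) powr (s - 1) * norm (F (x + h) - F x) \<le> \<dots>" .
      moreover have "C * norm (F (x + h) - F x) \<le> M * norm (F (x + h) - F x)"
        by (intro mult_right_mono) (auto simp: M_def)
      ultimately show ?thesis by (simp add: distrib_right)
    qed
    have T0: "0 \<le> T n x" for x by (simp add: T_def)
    have "(\<integral>\<^sup>+x. (norm (F x) powr (s - 1) + C) * norm (F (x + h) - F x) \<partial>lborel)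
       \<le> (\<integral>\<^sup>+x. ennreal M * ennreal (norm (F (x + h) - F x)) + (ennreal (2 / \<delta>) * ennreal (T n x) + ennreal \<delta> * ennreal (norm (F (x + h)) powr s)) \<partial>lborel)"
    proof (intro nn_integral_mono)
      fix x
      have "ennreal M * ennreal (norm (F (x + h) - F x)) + (ennreal (2 / \<delta>) * ennreal (T n x) + ennreal \<delta> * ennreal (norm (F (x + h)) powr s))
        = ennreal (M * norm (F (x + h) - F x) + ((2 / \<delta>) * T n x + \<delta> * norm (F (x + h)) powr s))"
        using \<delta> M T0[of x] by (simp flip: ennreal_mult ennreal_plus)
      then show "ennreal ((norm (F x) powr (s - 1) + C) * norm (F (x + h) - F x))
        \<le> ennreal M * ennreal (norm (F (x + h) - F x)) + (ennreal (2 / \<delta>) * ennreal (T n x) + ennreal \<delta> * ennreal (norm (F (x + h)) powr s))"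
        using ennreal_leI[OF pw[of x]] by simp
    qed
    also have "\<dots> = ennreal M * (\<integral>\<^sup>+x. norm (F (x + h) - F x) \<partial>lborel)
        + (ennreal (2 / \<delta>) * (\<integral>\<^sup>+x. T n x \<partial>lborel) + ennreal \<delta> * (\<integral>\<^sup>+x. norm (F (x + h)) powr s \<partial>lborel))"
      by (simp add: nn_integral_add nn_integral_cmult)
    also have "(\<integral>\<^sup>+x. norm (F (x + h)) powr s \<partial>lborel) = ennreal I"
      unfolding I(1)[symmetric] by (rule nn_integral_lborel_shift) measurable
    also have "ennreal M * (\<integral>\<^sup>+x. norm (F (x + h) - F x) \<partial>lborel) + (ennreal (2 / \<delta>) * (\<integral>\<^sup>+x. T n x \<partial>lborel) + ennreal \<delta> * ennreal I)
       \<le> ennreal M * ennreal (e / (3 * (M + 1))) + (ennreal (2 / \<delta>) * ennreal (\<delta> * e / 6) + ennreal \<delta> * ennreal I)"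
      using d(2)[OF h] n T0 by (intro add_mono mult_left_mono) auto
    also have "\<dots> = ennreal (M * (e / (3 * (M + 1))) + ((2 / \<delta>) * (\<delta> * e / 6) + \<delta> * I))"
      using \<delta> M I(2) \<open>0 < e\<close> by (simp flip: ennreal_mult ennreal_plus)
    also have "\<dots> \<le> ennreal e"
    proof (rule ennreal_leI)
      have 1: "M * (e / (3 * (M + 1))) \<le> e / 3" using M \<open>0 < e\<close> by (simp add: field_simps)
      have 2: "(2 / \<delta>) * (\<delta> * e / 6) = e / 3" using \<delta> by simp
      show "M * (e / (3 * (M + 1))) + ((2 / \<delta>) * (\<delta> * e / 6) + \<delta> * I) \<le> e"
        by (rule order_trans[OF add_mono[OF 1 add_mono[OF eq_refl[OF 2] \<delta>I]]]) simp
    qed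
    finally show "(\<integral>\<^sup>+x. (norm (F x) powr (s - 1) + C) * norm (F (x + h) - F x) \<partial>lborel) \<le> ennreal e" .
  qed (use d in auto)
qed

text \<open>
  The mollification error at \<open>x\<close> is an average of \<open>F (x + h) - F x\<close> over \<open>norm h < \<epsilon>\<close> with
  weight \<open>\<eta> h\<close>; after exchanging the integrals the hypothesis applies for each \<open>h\<close>.
\<close>

lemma weighted_mollification_error:
  fixes F :: "'a::euclidean_space \<Rightarrow> 'b::euclidean_space" and w :: "'a \<Rightarrow> real"
  assumes moll: "mollifier \<epsilon> \<eta> D\<eta>" and F: "integrable lborel F"
    and w[measurable]: "w \<in> borel_measurable borel" and w0: "\<And>x. 0 \<le> w x"
    and small: "\<And>h. norm h < \<epsilon> \<Longrightarrow> (\<integral>\<^sup>+x. w x * norm (F (x + h) - F x) \<partial>lborel) \<le> ennreal e"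
  shows "(\<integral>\<^sup>+x. w x * norm ((\<integral>y. \<eta> (x - y) *\<^sub>R F y \<partial>lborel) - F x) \<partial>lborel) \<le> ennreal e"
proof -
  have grad: "\<And>z. GDERIV \<eta> z :> D\<eta> z" and nn: "\<And>z. 0 \<le> \<eta> z"
    and zero: "\<And>z. \<epsilon> \<le> norm z \<Longrightarrow> \<eta> z = 0" and even: "\<And>z. \<eta> (- z) = \<eta> z"
    and one: "(\<integral>z. \<eta> z \<partial>lborel) = 1"
    using moll by (auto simp: mollifier_def)
  have cont\<eta>: "continuous_on UNIV \<eta>" using grad by (rule GDERIV_continuous_on)
  note [continuous_intros] = continuous_on_compose2[OF cont\<eta>]
  have [measurable]: "\<eta> \<in> borel_measurable borel" using cont\<eta> by (rule borel_measurable_continuous_onI)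
  have [measurable]: "F \<in> borel_measurable borel"
    using F by (auto dest!: borel_measurable_integrable)
  have int\<eta>: "integrable lborel \<eta>"
    using one not_integrable_integral_eq by fastforce
  have nn1: "(\<integral>\<^sup>+z. \<eta> z \<partial>lborel) = 1"
    using nn_integral_eq_integral[OF int\<eta>] nn one by simp
  have bd\<eta>: "\<exists>B. \<forall>z. \<eta> z \<le> B"
  proof -
    have "compact (\<eta> ` cball 0 \<epsilon>)" by (intro compact_continuous_image continuous_on_subset[OF cont\<eta>]) auto
    then obtain B where "\<And>z. z \<in> cball 0 \<epsilon> \<Longrightarrow> norm (\<eta> z) \<le> B"
      using compact_imp_bounded bounded_iff by (metis imageI)
    then have "\<eta> z \<le> max B 0" for z
      using zero[of z] by (cases "norm z \<le> \<epsilon>") force+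
    then show ?thesis by blast
  qed
  then obtain B where B: "\<And>z. \<eta> z \<le> B" by blast
  have intF: "integrable lborel (\<lambda>y. \<eta> (x - y) *\<^sub>R F y)" for x
    by (rule Bochner_Integration.integrable_bound[of _ "\<lambda>y. B *\<^sub>R F y"])
       (use F B nn in \<open>auto intro!: mult_right_mono abs_ge_self order_trans[OF _ abs_ge_self]\<close>)
  have even': "\<eta> (x - y) = \<eta> (y - x)" for x y using even[of "x - y"] by simp
  have nnx: "(\<integral>\<^sup>+y. \<eta> (x - y) \<partial>lborel) = 1" for x
    using nn_integral_lborel_shift[of "\<lambda>y. ennreal (\<eta> y)" "-x"] nn1 even'[of x] by simp
  have int\<eta>x: "integrable lborel (\<lambda>y. \<eta> (x - y))" for x
    using nnx[of x] nn by (intro integrableI_nonneg) auto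
  have onex: "(\<integral>y. \<eta> (x - y) \<partial>lborel) = 1" for x
    using nnx[of x] nn by (subst integral_eq_nn_integral) auto
  have pw: "ennreal (norm ((\<integral>y. \<eta> (x - y) *\<^sub>R F y \<partial>lborel) - F x))
     \<le> (\<integral>\<^sup>+h. \<eta> h * norm (F (x + h) - F x) \<partial>lborel)" for x
  proof -
    have i2: "integrable lborel (\<lambda>y. \<eta> (x - y) *\<^sub>R F x)"
      using int\<eta>x by (rule integrable_scaleR_left)
    have "(\<integral>y. \<eta> (x - y) *\<^sub>R F y \<partial>lborel) - F x = (\<integral>y. \<eta> (x - y) *\<^sub>R F y - \<eta> (x - y) *\<^sub>R F x \<partial>lborel)"
      using intF i2 onex[of x] int\<eta>x by simp
    also have "ennreal (norm \<dots>) \<le> (\<integral>\<^sup>+y. norm (\<eta> (x - y) *\<^sub>R F y - \<eta> (x - y) *\<^sub>R F x) \<partial>lborel)"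
      by (intro integral_norm_bound_ennreal Bochner_Integration.integrable_diff intF i2)
    also have "\<dots> = (\<integral>\<^sup>+y. \<eta> (y - x) * norm (F y - F x) \<partial>lborel)"
      using nn by (intro nn_integral_cong) (simp add: even'[of x] flip: scaleR_right_diff_distrib)
    also have "\<dots> = (\<integral>\<^sup>+h. \<eta> (h + x - x) * norm (F (h + x) - F x) \<partial>lborel)"
      by (rule nn_integral_lborel_shift[symmetric]) measurable
    finally show ?thesis by (simp add: add.commute)
  qed
  have "(\<integral>\<^sup>+x. w x * norm ((\<integral>y. \<eta> (x - y) *\<^sub>R F y \<partial>lborel) - F x) \<partial>lborel)
     \<le> (\<integral>\<^sup>+x. ennreal (w x) * (\<integral>\<^sup>+h. \<eta> h * norm (F (x + h) - F x) \<partial>lborel) \<partial>lborel)"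
    using w0 by (intro nn_integral_mono) (auto simp: ennreal_mult intro!: mult_left_mono pw)
  also have "\<dots> = (\<integral>\<^sup>+x. (\<integral>\<^sup>+h. ennreal (\<eta> h) * ennreal (w x * norm (F (x + h) - F x)) \<partial>lborel) \<partial>lborel)"
    using w0 nn by (intro nn_integral_cong) (simp add: ennreal_mult mult_ac flip: nn_integral_cmult)
  also have "\<dots> = (\<integral>\<^sup>+h. (\<integral>\<^sup>+x. ennreal (\<eta> h) * ennreal (w x * norm (F (x + h) - F x)) \<partial>lborel) \<partial>lborel)"
    by (rule lborel_pair.Fubini') measurable
  also have "\<dots> = (\<integral>\<^sup>+h. ennreal (\<eta> h) * (\<integral>\<^sup>+x. ennreal (w x * norm (F (x + h) - F x)) \<partial>lborel) \<partial>lborel)"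
    by (simp add: nn_integral_cmult)
  also have "\<dots> \<le> (\<integral>\<^sup>+h. ennreal (\<eta> h) * ennreal e \<partial>lborel)"
  proof (rule nn_integral_mono)
    fix h
    show "ennreal (\<eta> h) * (\<integral>\<^sup>+x. ennreal (w x * norm (F (x + h) - F x)) \<partial>lborel) \<le> ennreal (\<eta> h) * ennreal e"
      by (cases "norm h < \<epsilon>") (use small zero in \<open>auto intro!: mult_left_mono\<close>)
  qed
  also have "\<dots> = ennreal e" by (simp add: nn_integral_multc nn1)
  finally show ?thesis .
qed

section \<open>Weak gradients and weak solutions\<close>

lemma compactly_containedI:
  assumes "compact K" "K \<subseteq> \<Omega>" "A \<subseteq> K"
  shows "A \<Subset> \<Omega>"
proof -
  have "closure A \<subseteq> K" using assms by (intro closure_minimal) (auto simp: compact_imp_closed)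
  moreover have "compact (closure A)"
    using bounded_subset[OF compact_imp_bounded[OF assms(1)] assms(3)] by (simp add: compact_closure)
  ultimately show ?thesis using assms(2) by (auto simp: compactly_contained_def)
qed

text \<open>
  Weak gradients are Lebesgue measurable, whereas the theorem of Tonelli needs functions that
  are jointly measurable on a product of Borel spaces. The passage to Borel representatives
  is made once here, one component at a time.
\<close>

lemma lebesgue_measurable_ex_borel:
  fixes f :: "'a::euclidean_space \<Rightarrow> 'b::euclidean_space"
  assumes "f \<in> borel_measurable lebesgue"
  shows "\<exists>g \<in> borel_measurable borel. AE x in lborel. f x = g x"
proof -
  have "\<exists>g. g \<in> borel_measurable lborel \<and> (AE x in lborel. f x \<bullet> b = g x)" for b
  proof -
    have "(\<lambda>x. f x \<bullet> b) \<in> borel_measurable lebesgue" using assms by measurable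
    from completion_ex_borel_measurable_real[OF this] show ?thesis by blast
  qed
  then obtain G where G: "\<And>b. G b \<in> borel_measurable lborel" "\<And>b. AE x in lborel. f x \<bullet> b = G b x"
    by metis
  have [measurable]: "G b \<in> borel_measurable borel" for b using G(1)[of b] by simp
  have "AE x in lborel. \<forall>b\<in>Basis. f x \<bullet> b = G b x"
    using G(2) by (intro AE_finite_allI) auto
  then have "AE x in lborel. f x = (\<Sum>b\<in>Basis. G b x *\<^sub>R b)"
    by eventually_elim (metis (mono_tags, lifting) euclidean_representation sum.cong)
  then show ?thesis by (intro bexI[of _ "\<lambda>x. \<Sum>b\<in>Basis. G b x *\<^sub>R b"]) auto
qed

lemma integral_lebesgue_on_eq_lborel:
  fixes h :: "'a::euclidean_space \<Rightarrow> 'b::euclidean_space"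
  assumes "open \<Omega>" and "h \<in> borel_measurable borel" and "\<And>x. x \<notin> \<Omega> \<Longrightarrow> h x = 0"
  shows "integral\<^sup>L (lebesgue_on \<Omega>) h = integral\<^sup>L lborel h"
proof -
  have "integral\<^sup>L (lebesgue_on \<Omega>) h = integral\<^sup>L lebesgue (\<lambda>x. indicator \<Omega> x *\<^sub>R h x)"
    using assms(1) by (intro integral_restrict_space) auto
  also have "(\<lambda>x. indicator \<Omega> x *\<^sub>R h x) = h" using assms(3) by (auto simp: indicator_def)
  also have "integral\<^sup>L lebesgue h = integral\<^sup>L lborel h"
    using assms(2) by (intro integral_completion) simp
  finally show ?thesis .
qed

lemma integral_lebesgue_on_AE_eq_lborel:
  fixes f h :: "'a::euclidean_space \<Rightarrow> 'b::euclidean_space"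
  assumes \<Omega>: "open \<Omega>" and f: "f \<in> borel_measurable (lebesgue_on \<Omega>)" and h: "h \<in> borel_measurable borel"
    and out: "\<And>x. x \<notin> \<Omega> \<Longrightarrow> h x = 0" and eq: "AE x in lborel. x \<in> \<Omega> \<longrightarrow> f x = h x"
  shows "integral\<^sup>L (lebesgue_on \<Omega>) f = integral\<^sup>L lborel h"
proof -
  have "integral\<^sup>L (lebesgue_on \<Omega>) f = integral\<^sup>L (lebesgue_on \<Omega>) h"
  proof (rule integral_cong_AE[OF f])
    show "h \<in> borel_measurable (lebesgue_on \<Omega>)"
      using h by (simp add: borel_measurable_if_lebesgue_on measurable_restrict_space1 measurable_completion)
    show "AE x in lebesgue_on \<Omega>. f x = h x"
      using \<Omega> AE_completion[OF eq] by (subst AE_restrict_space_iff) auto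
  qed
  then show ?thesis using integral_lebesgue_on_eq_lborel[OF \<Omega> h out] by simp
qed

text \<open>
  Cutting off outside \<open>K\<close> makes the representative globally integrable, so that it can be
  translated and convolved without regard to the domain.
\<close>

lemma Lp_loc_borel_representative:
  fixes Du :: "'a::euclidean_space \<Rightarrow> 'b::euclidean_space"
  assumes Lp: "Lp_loc p \<Omega> Du" and p: "1 \<le> p" and K: "compact K" "K \<subseteq> \<Omega>"
  obtains F where "F \<in> borel_measurable borel" "AE x in lborel. x \<in> K \<longrightarrow> Du x = F x"
    "\<And>x. x \<notin> K \<Longrightarrow> F x = 0" "integrable lborel F" "integrable lborel (\<lambda>x. norm (F x) powr p)"
proof -
  have [measurable]: "K \<in> sets borel" "K \<in> sets lebesgue" using K(1) by (auto simp: compact_imp_closed)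
  have "Du \<in> borel_measurable (lebesgue_on K)"
    using Lp K(2) by (auto simp: Lp_loc_def intro: measurable_restrict_mono)
  then have meas: "(\<lambda>x. indicator K x *\<^sub>R Du x) \<in> borel_measurable lebesgue"
    by (subst (asm) borel_measurable_restrict_space_iff) auto
  then obtain G where G[measurable]: "G \<in> borel_measurable borel"
      and GA: "AE x in lborel. indicator K x *\<^sub>R Du x = G x"
    using lebesgue_measurable_ex_borel by blast
  define F where "F = (\<lambda>x. indicator K x *\<^sub>R G x)"
  have F[measurable]: "F \<in> borel_measurable borel" unfolding F_def by measurable
  have FA: "AE x in lborel. x \<in> K \<longrightarrow> Du x = F x"
    using GA by eventually_elim (auto simp: F_def)
  have F0: "F x = 0" if "x \<notin> K" for x using that by (simp add: F_def)
  have "integrable (lebesgue_on K) (\<lambda>x. norm (Du x) powr p)"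
    using Lp K by (auto simp: Lp_loc_def)
  then have i1: "integrable lebesgue (\<lambda>x. indicator K x *\<^sub>R norm (Du x) powr p)"
    by (subst (asm) integrable_restrict_space) auto
  have Fm: "(\<lambda>x. norm (F x) powr p) \<in> borel_measurable borel" by measurable
  have "integrable lebesgue (\<lambda>x. norm (F x) powr p)"
  proof (rule Bochner_Integration.integrable_bound[OF i1])
    show "(\<lambda>x. norm (F x) powr p) \<in> borel_measurable lebesgue"
      using Fm by (simp add: measurable_completion)
    show "AE x in lebesgue. norm (norm (F x) powr p) \<le> norm (indicator K x *\<^sub>R norm (Du x) powr p)"
      using AE_completion[OF FA] by eventually_elim (auto simp: indicator_def F0)
  qed
  then have Fp: "integrable lborel (\<lambda>x. norm (F x) powr p)"
    using Fm by (subst (asm) integrable_completion) auto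
  have iK: "integrable lborel (\<lambda>x. indicator K x + norm (F x) powr p)"
  proof (intro Bochner_Integration.integrable_add Fp)
    have "emeasure lborel K < \<infinity>" using K(1) by (rule emeasure_compact_finite)
    then show "integrable lborel (indicator K :: 'a \<Rightarrow> real)" by (intro integrable_real_indicator) auto
  qed
  have "integrable lborel F"
  proof (rule Bochner_Integration.integrable_bound[OF iK])
    show "AE x in lborel. norm (F x) \<le> norm (indicator K x + norm (F x) powr p)"
    proof (rule AE_I2)
      fix x
      have "norm (F x) \<le> 1 + norm (F x) powr p"
      proof (cases "norm (F x) \<le> 1")
        case False
        then have "norm (F x) powr 1 \<le> norm (F x) powr p" using p by (intro powr_mono) auto
        then show ?thesis by simp
      qed (simp add: add_increasing2)
      then show "norm (F x) \<le> norm (indicator K x + norm (F x) powr p)"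
        by (cases "x \<in> K") (auto simp: F0)
    qed
  qed auto
  then show ?thesis using that F FA F0 Fp by blast
qed

text \<open>
  The gradient of the mollified function is the mollified weak gradient: this is the defining
  identity of the weak gradient, tested with \<open>\<eta> (x - y)\<close> as a function of \<open>y\<close>.
\<close>

lemma weak_gradient_convolution:
  fixes \<Omega> :: "'a::euclidean_space set"
  assumes wg: "weak_gradient \<Omega> u Du" and \<Omega>: "open \<Omega>" and Du: "Du \<in> borel_measurable (lebesgue_on \<Omega>)"
    and moll: "mollifier \<epsilon> \<eta> D\<eta>" and xK: "cball x \<epsilon> \<subseteq> K" and K: "K \<subseteq> \<Omega>"
    and U: "continuous_on UNIV U" "\<And>y. y \<in> K \<Longrightarrow> U y = u y"
    and F: "F \<in> borel_measurable borel" "AE y in lborel. y \<in> K \<longrightarrow> Du y = F y"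
  shows "(\<integral>y. U y *\<^sub>R D\<eta> (x - y) \<partial>lborel) = (\<integral>y. \<eta> (x - y) *\<^sub>R F y \<partial>lborel)"
proof -
  have grad: "\<And>z. GDERIV \<eta> z :> D\<eta> z" and contD: "continuous_on UNIV D\<eta>"
    and zero: "\<And>z. \<epsilon> \<le> norm z \<Longrightarrow> \<eta> z = 0"
    using moll by (auto simp: mollifier_def)
  have cont\<eta>: "continuous_on UNIV \<eta>" using grad by (rule GDERIV_continuous_on)
  note [continuous_intros] = continuous_on_compose2[OF cont\<eta>] continuous_on_compose2[OF contD]
    continuous_on_compose2[OF U(1)]
  have zeroD: "D\<eta> z = 0" if "\<epsilon> < norm z" for z
    by (rule GDERIV_eq_0_on_open[OF grad, of "{z. \<epsilon> < norm z}"])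
       (use that zero in \<open>auto intro!: open_Collect_less continuous_intros\<close>)
  have out: "\<eta> (x - y) = 0 \<and> D\<eta> (x - y) = 0" if "y \<notin> K" for y
  proof -
    have "y \<notin> cball x \<epsilon>" using that xK by blast
    then have "\<epsilon> < norm (x - y)" by (simp add: dist_norm)
    then show ?thesis using zero zeroD by simp
  qed
  have [measurable]: "\<eta> \<in> borel_measurable borel" "D\<eta> \<in> borel_measurable borel"
    "U \<in> borel_measurable borel" "F \<in> borel_measurable borel"
    using cont\<eta> contD U(1) F(1) by (auto intro: borel_measurable_continuous_onI)
  have test: "C01 \<Omega> (\<lambda>y. \<eta> (x - y)) (\<lambda>y. - D\<eta> (x - y))"
    unfolding C01_def
  proof (intro conjI allI)
    fix y
    have "((\<lambda>y. \<eta> (x - y)) has_derivative (\<lambda>h. (- h) \<bullet> D\<eta> (x - y))) (at y)"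
      using grad[of "x - y"] unfolding gderiv_def
      by (rule has_derivative_compose[rotated]) (auto intro!: derivative_eq_intros)
    then show "GDERIV (\<lambda>y. \<eta> (x - y)) y :> - D\<eta> (x - y)" by (simp add: gderiv_def)
    show "continuous_on UNIV (\<lambda>y. - D\<eta> (x - y))" by (intro continuous_intros) auto
    have "{y. \<eta> (x - y) \<noteq> 0} \<subseteq> cball x \<epsilon>" using zero by (force simp: dist_norm)
    then show "{y. \<eta> (x - y) \<noteq> 0} \<Subset> \<Omega>"
      by (rule compactly_containedI[OF compact_cball subset_trans[OF xK K]])
  qed
  have "(\<integral>y. U y *\<^sub>R D\<eta> (x - y) \<partial>lborel) = (\<integral>y. U y *\<^sub>R D\<eta> (x - y) \<partial>lebesgue_on \<Omega>)"
    using out K by (intro integral_lebesgue_on_eq_lborel[symmetric] \<Omega>) auto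
  also have "\<dots> = (\<integral>y. u y *\<^sub>R D\<eta> (x - y) \<partial>lebesgue_on \<Omega>)"
  proof (intro Bochner_Integration.integral_cong refl)
    fix y
    show "U y *\<^sub>R D\<eta> (x - y) = u y *\<^sub>R D\<eta> (x - y)"
      by (cases "y \<in> K") (simp_all add: U(2) out)
  qed
  also have "\<dots> = - (\<integral>y. u y *\<^sub>R (- D\<eta> (x - y)) \<partial>lebesgue_on \<Omega>)"
    by simp
  also have "\<dots> = (\<integral>y. \<eta> (x - y) *\<^sub>R Du y \<partial>lebesgue_on \<Omega>)"
  proof -
    have "(\<integral>y. u y *\<^sub>R (- D\<eta> (x - y)) \<partial>lebesgue_on \<Omega>) = - (\<integral>y. \<eta> (x - y) *\<^sub>R Du y \<partial>lebesgue_on \<Omega>)"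
      using wg test unfolding weak_gradient_def by blast
    then show ?thesis by (simp only: minus_minus)
  qed
  also have "\<dots> = (\<integral>y. \<eta> (x - y) *\<^sub>R F y \<partial>lborel)"
  proof (rule integral_lebesgue_on_AE_eq_lborel[OF \<Omega>])
    have "(\<lambda>y. \<eta> (x - y)) \<in> borel_measurable (lebesgue_on \<Omega>)"
      by (intro measurable_restrict_space1 measurable_completion) measurable
    then show "(\<lambda>y. \<eta> (x - y) *\<^sub>R Du y) \<in> borel_measurable (lebesgue_on \<Omega>)" using Du by measurable
    show "AE y in lborel. y \<in> \<Omega> \<longrightarrow> \<eta> (x - y) *\<^sub>R Du y = \<eta> (x - y) *\<^sub>R F y"
      using F(2) by eventually_elim (use out in auto)
  qed (use out K in auto)
  finally show ?thesis .
qed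

lemma C01_outside_eq_0:
  assumes "C01 \<Omega> \<phi> D\<phi>" "closed K" "\<And>y. y \<notin> K \<Longrightarrow> \<phi> y = 0" "x \<notin> K"
  shows "D\<phi> x = 0"
  using assms by (intro GDERIV_eq_0_on_open[of \<phi> x "D\<phi> x" "- K"]) (auto simp: C01_def)

lemma flux_integral_borel_representative:
  fixes \<Omega> :: "'a::euclidean_space set"
  assumes \<Omega>: "open \<Omega>" and Du: "Du \<in> borel_measurable (lebesgue_on \<Omega>)"
    and F: "F \<in> borel_measurable borel" "AE y in lborel. y \<in> K \<longrightarrow> Du y = F y"
    and K: "closed K" "K \<subseteq> \<Omega>"
    and test: "C01 \<Omega> \<phi> D\<phi>" "\<And>y. y \<notin> K \<Longrightarrow> \<phi> y = 0"
  shows "(\<integral>x. norm (Du x) powr s * (Du x \<bullet> D\<phi> x) \<partial>lebesgue_on \<Omega>)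
    = (\<integral>x. (norm (F x) powr s *\<^sub>R F x) \<bullet> D\<phi> x \<partial>lborel)"
proof (rule integral_lebesgue_on_AE_eq_lborel[OF \<Omega>])
  have out: "D\<phi> x = 0" if "x \<notin> K" for x
    using C01_outside_eq_0[OF test(1) K(1) test(2) that] by simp
  have [measurable]: "F \<in> borel_measurable borel" "D\<phi> \<in> borel_measurable borel"
    using test(1) F(1) by (auto simp: C01_def intro: borel_measurable_continuous_onI)
  have "D\<phi> \<in> borel_measurable (lebesgue_on \<Omega>)"
    by (intro measurable_restrict_space1 measurable_completion) measurable
  then show "(\<lambda>x. norm (Du x) powr s * (Du x \<bullet> D\<phi> x)) \<in> borel_measurable (lebesgue_on \<Omega>)"
    using Du by measurable
  show "(\<lambda>x. (norm (F x) powr s *\<^sub>R F x) \<bullet> D\<phi> x) \<in> borel_measurable borel" by measurable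
  show "(norm (F x) powr s *\<^sub>R F x) \<bullet> D\<phi> x = 0" if "x \<notin> \<Omega>" for x
    using out[of x] that K(2) subsetD by fastforce
  show "AE x in lborel. x \<in> \<Omega> \<longrightarrow> norm (Du x) powr s * (Du x \<bullet> D\<phi> x) = (norm (F x) powr s *\<^sub>R F x) \<bullet> D\<phi> x"
    using F(2) by eventually_elim (use out in auto)
qed

text \<open>
  Off the compact set \<open>K0\<close> the function is locally zero, so cutting it off at the sphere does
  not spoil differentiability.
\<close>

lemma comparison_test_function:
  fixes w :: "'a::euclidean_space \<Rightarrow> real"
  assumes grad: "\<And>x. GDERIV w x :> Dw x" and contD: "continuous_on UNIV Dw"
    and K0: "compact K0" "K0 \<subseteq> ball a r" and B: "ball a r \<subseteq> \<Omega>"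
    and neg: "\<And>x. x \<in> ball a r - K0 \<Longrightarrow> w x \<le> 0"
  shows "C01 \<Omega> (\<lambda>x. if x \<in> ball a r then (max (w x) 0)\<^sup>2 else 0)
     (\<lambda>x. if x \<in> ball a r then (2 * max (w x) 0) *\<^sub>R Dw x else 0)" (is "C01 \<Omega> ?\<phi> ?D")
  unfolding C01_def
proof (intro conjI allI)
  have contw: "continuous_on UNIV w" using grad by (rule GDERIV_continuous_on)
  have opK: "open (- K0)" using K0(1) by (simp add: compact_imp_closed open_Compl)
  have zero: "?\<phi> x = 0" "?D x = 0" if "x \<in> - K0" for x using neg[of x] that by (auto simp: max_def)
  fix x
  have g: "GDERIV (\<lambda>x. (max (w x) 0)\<^sup>2) x :> (2 * max (w x) 0) *\<^sub>R Dw x" for x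
    by (rule GDERIV_DERIV_compose[OF grad positive_part_square_deriv])
  show "GDERIV ?\<phi> x :> ?D x"
  proof (cases "x \<in> K0")
    case True
    then have x: "x \<in> ball a r" using K0(2) by blast
    show ?thesis
      using g[of x] x unfolding gderiv_def
      by (auto intro: has_derivative_transform_within_open[OF _ open_ball x])
  next
    case False
    then have "x \<in> - K0" by simp
    have "(?\<phi> has_derivative (\<lambda>h. 0)) (at x)"
      by (rule has_derivative_transform_within_open[OF has_derivative_const[of 0] opK \<open>x \<in> - K0\<close>])
         (use zero in auto)
    then show ?thesis using zero(2)[OF \<open>x \<in> - K0\<close>] by (simp only: gderiv_def inner_zero_right)
  qed
  have "continuous_on (ball a r \<union> - K0) ?D"
  proof (rule continuous_on_open_Un)
    have "continuous_on (ball a r) (\<lambda>x. (2 * max (w x) 0) *\<^sub>R Dw x)"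
      using contw contD by (intro continuous_intros) (auto intro: continuous_on_subset)
    then show "continuous_on (ball a r) ?D" by (rule continuous_on_cong[THEN iffD1, rotated -1]) auto
    have "continuous_on (- K0) (\<lambda>x. 0 :: 'a)" by simp
    then show "continuous_on (- K0) ?D" by (rule continuous_on_cong[THEN iffD1, rotated -1]) (use zero in auto)
  qed (use opK in auto)
  moreover have "ball a r \<union> - K0 = UNIV" using K0(2) by blast
  ultimately show "continuous_on UNIV ?D" by simp
  have "{x. ?\<phi> x \<noteq> 0} \<subseteq> K0" using zero by blast
  then show "{x. ?\<phi> x \<noteq> 0} \<Subset> \<Omega>"
    by (rule compactly_containedI[OF K0(1) subset_trans[OF K0(2) B]])
qed

section \<open>Comparison with a smooth function\<close>

text \<open>
  If \<open>u\<close> lies below \<open>v\<close> on the sphere, the squared positive part of \<open>u - v\<close> would be the test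
  function to use in the ball. Testing with its mollified version \<open>\<phi>\<close> replaces the unknown flux
  of \<open>u\<close> by the flux of \<open>v\<close>, at the price of an inequality and of an error \<open>e\<close>. The bound \<open>\<sigma>\<close> on
  \<open>ue - u\<close> lets the sign of \<open>ue - v\<close> be read off from \<open>u\<close>.
\<close>

lemma weak_solution_approximate_comparison:
  fixes \<Omega> :: "'a::euclidean_space set"
  assumes \<Omega>: "open \<Omega>" and p: "2 \<le> p" and sol: "weak_solution p q lam g \<Omega> u"
    and B: "cball a r \<subseteq> \<Omega>" and r: "0 < r"
    and gradv: "\<And>x. GDERIV v x :> Dv x" and contDv: "continuous_on UNIV Dv"
    and less: "\<And>x. x \<in> sphere a r \<Longrightarrow> u x < v x"
    and \<sigma>: "0 < \<sigma>" and e: "0 < e"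
  obtains ue \<phi> D\<phi> where "\<And>x. x \<in> cball a r \<Longrightarrow> \<bar>ue x - u x\<bar> \<le> \<sigma>" "C01 \<Omega> \<phi> D\<phi>"
    "\<And>x. \<phi> x = (if x \<in> ball a r then (max (ue x - v x) 0)\<^sup>2 else 0)"
    "(\<integral>x. (norm (Dv x) powr (p - 2) *\<^sub>R Dv x) \<bullet> D\<phi> x \<partial>lborel)
       + (\<integral>x. lam x * max (u x) 0 powr q * \<phi> x \<partial>lebesgue_on \<Omega>) \<le> e"
proof -
  obtain Du where W: "W1p_loc p \<Omega> u Du"
    and weak: "\<And>\<phi> D\<phi>. C01 \<Omega> \<phi> D\<phi> \<Longrightarrow> (\<forall>x. 0 \<le> \<phi> x) \<Longrightarrow>
        (\<integral>x. norm (Du x) powr (p - 2) * (Du x \<bullet> D\<phi> x) \<partial>lebesgue_on \<Omega>)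
          = - (\<integral>x. lam x * max (u x) 0 powr q * \<phi> x \<partial>lebesgue_on \<Omega>)"
    and contu: "continuous_on (closure \<Omega>) u"
    using sol unfolding weak_solution_def by blast
  have wg: "weak_gradient \<Omega> u Du" and Lp: "Lp_loc p \<Omega> Du"
    using W by (auto simp: W1p_loc_def)
  have Dum: "Du \<in> borel_measurable (lebesgue_on \<Omega>)" using Lp by (simp add: Lp_loc_def)
  obtain \<rho> where \<rho>: "\<rho> > 0" "(\<Union>x\<in>cball a r. cball x \<rho>) \<subseteq> \<Omega>"
    using compact_subset_open_imp_cball_epsilon_subset[OF compact_cball \<Omega> B] by blast
  define K where "K = cball a (r + \<rho>)"
  have K: "compact K" "closed K" by (auto simp: K_def)
  have K\<Omega>: "K \<subseteq> \<Omega>"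
  proof
    fix y assume y: "y \<in> K"
    show "y \<in> \<Omega>"
    proof (cases "y \<in> cball a r")
      case False
      \<comment> \<open>Project \<open>y\<close> radially onto the sphere.\<close>
      define t where "t = r / dist a y"
      have d: "r < dist a y" "dist a y \<le> r + \<rho>" using y False by (auto simp: K_def)
      define z where "z = a + t *\<^sub>R (y - a)"
      have d0: "dist a y > 0" using d r by linarith
      have "dist a z = r" using r d0 by (simp add: z_def t_def dist_norm norm_minus_commute)
      moreover have "dist z y \<le> \<rho>"
      proof -
        have "y - z = (1 - t) *\<^sub>R (y - a)" by (simp add: z_def algebra_simps)
        then have "dist z y = \<bar>1 - t\<bar> * dist a y" by (simp add: dist_norm norm_minus_commute)
        also have "\<dots> = dist a y - r" using d d0 by (simp add: t_def field_simps)
        finally show ?thesis using d by simp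
      qed
      ultimately show ?thesis using \<rho>(2) by force
    qed (use B in blast)
  qed
  have BK: "cball x \<rho> \<subseteq> K" if "x \<in> cball a r" for x
  proof
    fix y assume "y \<in> cball x \<rho>"
    then show "y \<in> K" using that dist_triangle[of a y x] by (simp add: K_def)
  qed
  have cBK: "cball a r \<subseteq> K" using \<rho>(1) by (auto simp: K_def)
  have contuK: "continuous_on K u"
    using contu by (rule continuous_on_subset) (use K\<Omega> closure_subset in blast)
  obtain Bu where Bu: "0 \<le> Bu" "\<And>x. x \<in> K \<Longrightarrow> norm (u x) \<le> Bu"
  proof -
    have "bounded (u ` K)" using contuK K(1) by (intro compact_imp_bounded compact_continuous_image)
    then obtain b where "b > 0" "\<And>x. x \<in> K \<Longrightarrow> norm (u x) \<le> b" unfolding bounded_pos by blast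
    then show ?thesis by (intro that[of b]) auto
  qed
  \<comment> \<open>A global continuous extension can be convolved everywhere.\<close>
  obtain U where U: "continuous_on UNIV U" "\<And>x. x \<in> K \<Longrightarrow> U x = u x"
  proof (rule Tietze[OF contuK, of UNIV Bu])
    show "closedin (top_of_set UNIV) K" using K(2) by simp
  qed (use Bu in auto)
  obtain F where F[measurable]: "F \<in> borel_measurable borel" and FA: "AE x in lborel. x \<in> K \<longrightarrow> Du x = F x"
    and F0: "\<And>x. x \<notin> K \<Longrightarrow> F x = 0" and F1: "integrable lborel F"
    and Fp: "integrable lborel (\<lambda>x. norm (F x) powr p)"
    using Lp_loc_borel_representative[OF Lp _ K(1) K\<Omega>] p by auto
  have contv: "continuous_on UNIV v" using gradv by (rule GDERIV_continuous_on)
  define V where "V = (\<lambda>x. norm (Dv x) powr (p - 2) *\<^sub>R Dv x)"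
  have normV: "norm (V x) = norm (Dv x) powr (p - 1)" for x
    by (cases "Dv x = 0") (auto simp: V_def powr_diff power2_eq_square)
  have bound: "\<exists>C\<ge>0. \<forall>x\<in>cball a r. norm (h x) \<le> C" if "continuous_on (cball a r) h"
    for h :: "'a \<Rightarrow> 'c::real_normed_vector"
  proof -
    have "bounded (h ` cball a r)" using that by (intro compact_imp_bounded compact_continuous_image) auto
    then obtain b where "b > 0" "\<And>x. x \<in> cball a r \<Longrightarrow> norm (h x) \<le> b" unfolding bounded_pos by blast
    then show ?thesis by (intro exI[of _ b]) auto
  qed
  obtain C1 where C1: "0 \<le> C1" "\<And>x. x \<in> cball a r \<Longrightarrow> norm (Dv x) \<le> C1"
    using bound[OF continuous_on_subset[OF contDv]] by blast
  define C where "C = C1 powr (p - 1)"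
  have C: "0 \<le> C" "\<And>x. x \<in> cball a r \<Longrightarrow> norm (V x) \<le> C"
    using C1 p by (auto simp: C_def normV intro!: powr_mono2)
  obtain Cw where Cw: "0 \<le> Cw" "\<And>x. x \<in> cball a r \<Longrightarrow> norm (u x - v x) \<le> Cw"
    using bound[OF continuous_on_diff[OF continuous_on_subset[OF contuK cBK] continuous_on_subset[OF contv subset_UNIV]]]
    by blast
  \<comment> \<open>By compactness \<open>u\<close> is uniformly below \<open>v\<close> on the sphere, so an approximation of \<open>u\<close> up
     to \<open>\<tau>\<close> exceeds \<open>v\<close> only on a compact part \<open>K0\<close> of the open ball.\<close>
  obtain \<tau> where \<tau>: "0 < \<tau>" "\<And>x. x \<in> sphere a r \<Longrightarrow> u x - v x < - \<tau>"
  proof -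
    have "sphere a r \<noteq> {}" using r by simp
    moreover have "continuous_on (sphere a r) (\<lambda>x. u x - v x)"
    proof (rule continuous_on_diff)
      have "sphere a r \<subseteq> K" using cBK sphere_cball by blast
      then show "continuous_on (sphere a r) u" by (rule continuous_on_subset[OF contuK])
      show "continuous_on (sphere a r) v" by (rule continuous_on_subset[OF contv subset_UNIV])
    qed
    ultimately obtain y where y: "y \<in> sphere a r" "\<And>x. x \<in> sphere a r \<Longrightarrow> u x - v x \<le> u y - v y"
      using continuous_attains_sup[OF compact_sphere] by blast
    show ?thesis
    proof (rule that[of "(v y - u y) / 2"])
      show "0 < (v y - u y) / 2" using less[OF y(1)] by simp
      show "u x - v x < - ((v y - u y) / 2)" if "x \<in> sphere a r" for x
        using y(2)[OF that] less[OF y(1)] by (simp add: field_simps)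
    qed
  qed
  define K0 where "K0 = {x \<in> cball a r. - \<tau> \<le> U x - v x}"
  have K0: "compact K0" "K0 \<subseteq> ball a r"
  proof -
    have "closed {x. - \<tau> \<le> U x - v x}"
      using U(1) contv by (intro closed_Collect_le continuous_intros)
    then have "compact (cball a r \<inter> {x. - \<tau> \<le> U x - v x})" by (intro compact_Int_closed compact_cball)
    also have "cball a r \<inter> {x. - \<tau> \<le> U x - v x} = K0" by (auto simp: K0_def)
    finally show "compact K0" .
    show "K0 \<subseteq> ball a r"
    proof
      fix x assume x: "x \<in> K0"
      then have xc: "x \<in> cball a r" "- \<tau> \<le> U x - v x" by (simp_all add: K0_def)
      then have "U x = u x" using cBK by (intro U(2)) blast
      then have "x \<notin> sphere a r" using \<tau>(2)[of x] xc(2) by linarith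
      then show "x \<in> ball a r" using xc(1) by simp
    qed
  qed
  define \<sigma>' where "\<sigma>' = min \<sigma> \<tau>"
  define Wb where "Wb = 2 * (Cw + \<sigma>')"
  have \<sigma>': "0 < \<sigma>'" "\<sigma>' \<le> \<sigma>" "\<sigma>' \<le> \<tau>" using \<sigma> \<tau> by (auto simp: \<sigma>'_def)
  have Wb: "0 < Wb" using Cw \<sigma>' by (simp add: Wb_def)
  \<comment> \<open>The factor \<open>2 * max (ue - v) 0\<close> in the gradient of \<open>\<phi>\<close> will be at most \<open>Wb\<close>; hence the
     tolerance \<open>e / Wb\<close> for the mollification error.\<close>
  obtain d1 where d1: "0 < d1" "\<And>x y. x \<in> K \<Longrightarrow> y \<in> K \<Longrightarrow> dist x y < d1 \<Longrightarrow> \<bar>U y - U x\<bar> \<le> \<sigma>'"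
  proof -
    have "uniformly_continuous_on K U"
      using continuous_on_subset[OF U(1)] K(1) by (intro compact_uniformly_continuous) auto
    then obtain d where "0 < d" "\<And>x y. x \<in> K \<Longrightarrow> y \<in> K \<Longrightarrow> dist y x < d \<Longrightarrow> dist (U y) (U x) < \<sigma>'"
      using \<sigma>'(1) unfolding uniformly_continuous_on_def by metis
    then show ?thesis by (intro that[of d]) (auto simp: dist_commute dist_real_def less_imp_le)
  qed
  obtain d2 where d2: "0 < d2" "\<And>h. norm h < d2 \<Longrightarrow>
      (\<integral>\<^sup>+x. (norm (F x) powr (p - 1) + C) * norm (F (x + h) - F x) \<partial>lborel) \<le> ennreal (e / Wb)"
    using weighted_translation_continuous[OF p F1 Fp, of "e / Wb" C] e Wb C(1) by auto
  define \<epsilon> where "\<epsilon> = min \<rho> (min d1 d2)"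
  have \<epsilon>: "0 < \<epsilon>" "\<epsilon> \<le> \<rho>" "\<epsilon> \<le> d1" "\<epsilon> \<le> d2" using \<rho>(1) d1(1) d2(1) by (auto simp: \<epsilon>_def)
  obtain \<eta> :: "'a \<Rightarrow> real" and D\<eta> where moll: "mollifier \<epsilon> \<eta> D\<eta>"
    using mollifier_exists[OF \<epsilon>(1)] by blast
  define ue where "ue = (\<lambda>x. \<integral>y. \<eta> (x - y) * U y \<partial>lborel)"
  define Gue where "Gue = (\<lambda>x. \<integral>y. U y *\<^sub>R D\<eta> (x - y) \<partial>lborel)"
  define Fe where "Fe = (\<lambda>x. \<integral>y. \<eta> (x - y) *\<^sub>R F y \<partial>lborel)"
  have gradue: "GDERIV ue x :> Gue x" and contGue: "isCont Gue x" for x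
    using convolution_GDERIV[OF moll U(1)] unfolding ue_def Gue_def by auto
  have cballK: "cball x \<epsilon> \<subseteq> K" if "x \<in> cball a r" for x
    using BK[OF that] \<epsilon>(2) by (meson subset_cball subset_trans)
  have ueU: "\<bar>ue x - u x\<bar> \<le> \<sigma>'" if x: "x \<in> cball a r" for x
  proof -
    have "\<bar>ue x - U x\<bar> \<le> \<sigma>'"
      unfolding ue_def
    proof (rule mollification_pointwise_error[OF moll U(1)])
      fix y assume y: "norm (x - y) < \<epsilon>"
      then have "y \<in> cball x \<epsilon>" by (simp add: dist_norm)
      then show "\<bar>U y - U x\<bar> \<le> \<sigma>'"
        using y \<epsilon>(3) cballK[OF x] cBK x by (intro d1(2)) (auto simp: dist_norm)
    qed
    then show ?thesis using U(2) x cBK by (auto simp: subset_iff)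
  qed
  have GueFe: "Gue x = Fe x" if "x \<in> cball a r" for x
    unfolding Gue_def Fe_def
    by (rule weak_gradient_convolution[OF wg \<Omega> Dum moll cballK[OF that] K\<Omega> U F FA])
  define \<phi> where "\<phi> = (\<lambda>x. if x \<in> ball a r then (max (ue x - v x) 0)\<^sup>2 else 0)"
  define D\<phi> where "D\<phi> = (\<lambda>x. if x \<in> ball a r then (2 * max (ue x - v x) 0) *\<^sub>R (Gue x - Dv x) else 0)"
  have C01: "C01 \<Omega> \<phi> D\<phi>"
    unfolding \<phi>_def D\<phi>_def
  proof (rule comparison_test_function[OF _ _ K0])
    show "GDERIV (\<lambda>x. ue x - v x) x :> Gue x - Dv x" for x
      by (intro GDERIV_diff gradue gradv)
    show "continuous_on UNIV (\<lambda>x. Gue x - Dv x)"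
      using contGue contDv by (intro continuous_on_diff) (auto intro: continuous_at_imp_continuous_on)
    show "ball a r \<subseteq> \<Omega>" using B by auto
    fix x assume x: "x \<in> ball a r - K0"
    then have "u x - v x < - \<tau>" using U(2) cBK by (auto simp: K0_def subset_iff)
    then show "ue x - v x \<le> 0" using ueU[of x] x \<sigma>'(3) by auto
  qed
  have \<phi>0: "0 \<le> \<phi> x" for x by (simp add: \<phi>_def)
  have \<phi>out: "\<phi> x = 0" if "x \<notin> K" for x
  proof -
    have "x \<notin> ball a r" using that cBK ball_subset_cball by blast
    then show ?thesis by (simp add: \<phi>_def)
  qed
  have D\<phi>c: "continuous_on UNIV D\<phi>" using C01 by (simp add: C01_def)
  have [measurable]: "D\<phi> \<in> borel_measurable borel" "Dv \<in> borel_measurable borel" "V \<in> borel_measurable borel"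
  proof -
    show "D\<phi> \<in> borel_measurable borel" "Dv \<in> borel_measurable borel"
      using D\<phi>c contDv by (auto intro: borel_measurable_continuous_onI)
    then show "V \<in> borel_measurable borel" unfolding V_def by measurable
  qed
  have D\<phi>out: "D\<phi> x = 0" if "x \<notin> cball a r" for x
    using that by (auto simp: D\<phi>_def)
  obtain Cd where Cd: "0 \<le> Cd" "\<And>x. x \<in> cball a r \<Longrightarrow> norm (D\<phi> x) \<le> Cd"
    using bound[OF continuous_on_subset[OF D\<phi>c]] by blast
  define A where "A = (\<lambda>x. norm (F x) powr (p - 2) *\<^sub>R F x)"
  have [measurable]: "A \<in> borel_measurable borel" unfolding A_def by measurable
  have normA: "norm (A x) = norm (F x) powr (p - 1)" for x
    by (cases "F x = 0") (auto simp: A_def powr_diff power2_eq_square)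
  have I1: "(\<integral>x. A x \<bullet> D\<phi> x \<partial>lborel) = - (\<integral>x. lam x * max (u x) 0 powr q * \<phi> x \<partial>lebesgue_on \<Omega>)"
    using weak[OF C01] \<phi>0 flux_integral_borel_representative[OF \<Omega> Dum F FA K(2) K\<Omega> C01 \<phi>out, of "p - 2"] by (simp add: A_def)
  \<comment> \<open>Both flux integrals are dominated by the integrable function
     \<open>indicator (cball a r) x + norm (F x) powr p\<close>, as \<open>t powr (p - 1) \<le> 1 + t powr p\<close>.\<close>
  have ibase: "integrable lborel (\<lambda>x. indicator (cball a r) x + norm (F x) powr p)"
  proof (intro Bochner_Integration.integrable_add Fp)
    have "emeasure lborel (cball a r) < \<infinity>" by (rule emeasure_compact_finite) simp
    then show "integrable lborel (indicator (cball a r) :: 'a \<Rightarrow> real)" by (intro integrable_real_indicator) auto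
  qed
  have iA: "integrable lborel (\<lambda>x. A x \<bullet> D\<phi> x)"
  proof (rule Bochner_Integration.integrable_bound)
    show "integrable lborel (\<lambda>x. Cd * (indicator (cball a r) x + norm (F x) powr p))" using ibase by simp
    show "AE x in lborel. norm (A x \<bullet> D\<phi> x) \<le> norm (Cd * (indicator (cball a r) x + norm (F x) powr p))"
    proof (rule AE_I2)
      fix x
      have "\<bar>A x \<bullet> D\<phi> x\<bar> \<le> Cd * (indicator (cball a r) x + norm (F x) powr p)"
      proof (cases "x \<in> cball a r")
        case True
        have "norm (F x) powr (p - 1) \<le> 1 + norm (F x) powr p"
        proof (cases "norm (F x) \<le> 1")
          case True
          then have "norm (F x) powr (p - 1) \<le> 1 powr (p - 1)" using p by (intro powr_mono2) auto
          then show ?thesis by (simp add: add_increasing2)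
        next
          case False
          then have "norm (F x) powr (p - 1) \<le> norm (F x) powr p" by (intro powr_mono) auto
          then show ?thesis by simp
        qed
        moreover have "\<bar>A x \<bullet> D\<phi> x\<bar> \<le> norm (F x) powr (p - 1) * norm (D\<phi> x)"
          using Cauchy_Schwarz_ineq2[of "A x" "D\<phi> x"] by (simp add: normA)
        ultimately have "\<bar>A x \<bullet> D\<phi> x\<bar> \<le> (1 + norm (F x) powr p) * Cd"
          using Cd(2)[OF True] by (elim order_trans, intro mult_mono) auto
        then show ?thesis using True by (simp add: mult.commute)
      next
        case False
        then show ?thesis using Cd(1) by (simp add: D\<phi>out)
      qed
      then show "norm (A x \<bullet> D\<phi> x) \<le> norm (Cd * (indicator (cball a r) x + norm (F x) powr p))"
        unfolding real_norm_def by (rule order_trans[OF _ abs_ge_self])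
    qed
  qed measurable
  have iV: "integrable lborel (\<lambda>x. V x \<bullet> D\<phi> x)"
  proof (rule Bochner_Integration.integrable_bound)
    show "integrable lborel (\<lambda>x. (C * Cd) * (indicator (cball a r) x + norm (F x) powr p))" using ibase by simp
    show "AE x in lborel. norm (V x \<bullet> D\<phi> x) \<le> norm ((C * Cd) * (indicator (cball a r) x + norm (F x) powr p))"
    proof (rule AE_I2)
      fix x
      have "\<bar>V x \<bullet> D\<phi> x\<bar> \<le> (C * Cd) * (indicator (cball a r) x + norm (F x) powr p)"
      proof (cases "x \<in> cball a r")
        case True
        have "\<bar>V x \<bullet> D\<phi> x\<bar> \<le> norm (V x) * norm (D\<phi> x)" by (rule Cauchy_Schwarz_ineq2)
        also have "\<dots> \<le> C * Cd" using C Cd True by (intro mult_mono) auto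
        also have "\<dots> \<le> (C * Cd) * (1 + norm (F x) powr p)" using C(1) Cd(1) by (simp add: distrib_left)
        finally show ?thesis using True by simp
      next
        case False
        then show ?thesis using C(1) Cd(1) by (simp add: D\<phi>out)
      qed
      then show "norm (V x \<bullet> D\<phi> x) \<le> norm ((C * Cd) * (indicator (cball a r) x + norm (F x) powr p))"
        unfolding real_norm_def by (rule order_trans[OF _ abs_ge_self])
    qed
  qed measurable
  \<comment> \<open>\<open>E\<close> bounds the pairing of the flux difference with \<open>Fe - F\<close>; the pairing with \<open>F - Dv\<close>
     is nonnegative by monotonicity and is discarded.\<close>
  define E where "E = (\<lambda>x. (norm (F x) powr (p - 1) + C) * norm (Fe x - F x))"
  have Fem[measurable]: "Fe \<in> borel_measurable borel"
  proof -
    have [measurable]: "\<eta> \<in> borel_measurable borel"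
      using moll GDERIV_continuous_on[of \<eta> D\<eta>] by (auto simp: mollifier_def intro: borel_measurable_continuous_onI)
    show ?thesis unfolding Fe_def by measurable
  qed
  have [measurable]: "E \<in> borel_measurable borel" unfolding E_def by measurable
  have E0: "0 \<le> E x" for x using C(1) by (simp add: E_def)
  have nnE: "(\<integral>\<^sup>+x. E x \<partial>lborel) \<le> ennreal (e / Wb)"
    unfolding E_def Fe_def
    by (rule weighted_mollification_error[OF moll F1]) (use d2(2) \<epsilon>(4) C(1) in auto)
  have iE: "integrable lborel E"
    using nnE E0 by (intro integrableI_nonneg) (auto simp: order_le_less_trans)
  have intE: "(\<integral>x. E x \<partial>lborel) \<le> e / Wb"
    using nnE e Wb nn_integral_eq_integral[OF iE] E0 by (simp add: ennreal_le_iff)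
  have pw: "- (Wb * E x) \<le> A x \<bullet> D\<phi> x - V x \<bullet> D\<phi> x" for x
  proof (cases "x \<in> ball a r")
    case True
    then have x: "x \<in> cball a r" by simp
    define w where "w = 2 * max (ue x - v x) 0"
    have w: "0 \<le> w" "w \<le> Wb"
      using ueU[OF x] Cw(2)[OF x] \<sigma>' Cw(1) by (auto simp: w_def Wb_def max_def abs_le_iff)
    have D: "D\<phi> x = w *\<^sub>R (Fe x - F x) + w *\<^sub>R (F x - Dv x)"
      using True GueFe[OF x] by (simp add: D\<phi>_def w_def flip: scaleR_add_right)
    have "A x \<bullet> D\<phi> x - V x \<bullet> D\<phi> x = (A x - V x) \<bullet> D\<phi> x" by (simp add: inner_diff_left)
    also have "\<dots> = w * ((A x - V x) \<bullet> (Fe x - F x)) + w * ((A x - V x) \<bullet> (F x - Dv x))"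
      by (simp only: D inner_add_right inner_scaleR_right)
    finally have "A x \<bullet> D\<phi> x - V x \<bullet> D\<phi> x = w * ((A x - V x) \<bullet> (Fe x - F x)) + w * ((A x - V x) \<bullet> (F x - Dv x))" .
    moreover have "0 \<le> w * ((A x - V x) \<bullet> (F x - Dv x))"
      using powr_flux_monotone[of "p - 2" "F x" "Dv x"] p w by (simp add: A_def V_def)
    moreover have "\<bar>w * ((A x - V x) \<bullet> (Fe x - F x))\<bar> \<le> Wb * E x"
    proof -
      have "\<bar>(A x - V x) \<bullet> (Fe x - F x)\<bar> \<le> norm (A x - V x) * norm (Fe x - F x)" by (rule Cauchy_Schwarz_ineq2)
      also have "\<dots> \<le> E x"
        unfolding E_def using norm_triangle_ineq4[of "A x" "V x"] C(2)[OF x]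
        by (intro mult_right_mono) (auto simp: normA)
      finally have "w * \<bar>(A x - V x) \<bullet> (Fe x - F x)\<bar> \<le> Wb * E x"
        using w by (intro mult_mono) auto
      then show ?thesis using w by (simp add: abs_mult)
    qed
    ultimately show ?thesis by linarith
  next
    case False
    then show ?thesis using E0[of x] Wb by (simp add: D\<phi>_def)
  qed
  have "- (Wb * (\<integral>x. E x \<partial>lborel)) = (\<integral>x. - (Wb * E x) \<partial>lborel)" by simp
  also have "\<dots> \<le> (\<integral>x. A x \<bullet> D\<phi> x - V x \<bullet> D\<phi> x \<partial>lborel)"
    using iE iA iV pw by (intro integral_mono) auto
  also have "\<dots> = (\<integral>x. A x \<bullet> D\<phi> x \<partial>lborel) - (\<integral>x. V x \<bullet> D\<phi> x \<partial>lborel)"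
    by (rule Bochner_Integration.integral_diff[OF iA iV])
  finally have "(\<integral>x. V x \<bullet> D\<phi> x \<partial>lborel) + (\<integral>x. lam x * max (u x) 0 powr q * \<phi> x \<partial>lebesgue_on \<Omega>)
     \<le> Wb * (\<integral>x. E x \<partial>lborel)"
    using I1 by simp
  also have "\<dots> \<le> Wb * (e / Wb)" using intE Wb by (intro mult_left_mono) auto
  also have "\<dots> = e" using Wb by simp
  finally have fin: "(\<integral>x. V x \<bullet> D\<phi> x \<partial>lborel) + (\<integral>x. lam x * max (u x) 0 powr q * \<phi> x \<partial>lebesgue_on \<Omega>) \<le> e" .
  show ?thesis
  proof (rule that[of ue \<phi> D\<phi>])
    show "\<bar>ue x - u x\<bar> \<le> \<sigma>" if "x \<in> cball a r" for x using ueU[OF that] \<sigma>'(2) by simp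
  qed (use C01 fin in \<open>auto simp: V_def \<phi>_def\<close>)
qed

section \<open>The radial barrier and nondegeneracy for finite exponents\<close>

lemma integrable_lebesgue_on:
  fixes h :: "'a::euclidean_space \<Rightarrow> real"
  assumes "open \<Omega>" "integrable lborel h"
  shows "integrable (lebesgue_on \<Omega>) h"
proof -
  have "integrable lborel (\<lambda>x. indicator \<Omega> x *\<^sub>R h x)"
    using assms by (intro integrable_mult_indicator) auto
  then have "integrable lebesgue (\<lambda>x. indicator \<Omega> x *\<^sub>R h x)"
    by (subst integrable_completion) (auto dest: borel_measurable_integrable)
  then show ?thesis using assms(1) by (subst integrable_restrict_space) auto
qed

text \<open>
  The power \<open>norm y powr m\<close> extended continuously to the origin for \<open>m = 0\<close>, where
  \<open>0 powr 0 = 0\<close>.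
\<close>

definition radial_weight :: "real \<Rightarrow> 'a::real_normed_vector \<Rightarrow> real" where
  "radial_weight m y = (if m = 0 then 1 else norm y powr m)"

lemma radial_weight_nonneg: "0 \<le> radial_weight m y"
  by (simp add: radial_weight_def)

lemma continuous_radial_weight:
  assumes "0 \<le> m"
  shows "continuous_on UNIV (radial_weight m)"
proof (cases "m = 0")
  case False
  then have "continuous_on UNIV (\<lambda>y::'a. norm y powr m)"
    using assms by (intro continuous_on_powr' continuous_intros) auto
  then show ?thesis using False by (simp add: radial_weight_def[abs_def])
qed (simp add: radial_weight_def[abs_def])

lemma radial_weight_scaleR:
  assumes "0 < t"
  shows "radial_weight m (t *\<^sub>R y) = t powr m * radial_weight m y"
  using assms by (simp add: radial_weight_def powr_mult)

text \<open>
  The field \<open>(b * norm y powr (\<alpha> - 2)) *\<^sub>R y\<close> is the gradient of the barrier for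
  \<open>b = c * \<alpha>\<close>. The flux is a radial field with weight of degree \<open>\<alpha> * q\<close> because
  \<open>(\<alpha> - 1) * (p - 1) - 1 = \<alpha> * q\<close>.
\<close>

lemma barrier_flux:
  fixes y :: "'a::real_normed_vector" and p q \<alpha> b :: real
  assumes \<alpha>: "\<alpha> * (p - 1 - q) = p" and b: "0 \<le> b"
  shows "norm ((b * norm y powr (\<alpha> - 2)) *\<^sub>R y) powr (p - 2) *\<^sub>R ((b * norm y powr (\<alpha> - 2)) *\<^sub>R y)
    = (b powr (p - 1) * radial_weight (\<alpha> * q) y) *\<^sub>R y"
proof (cases "y = 0 \<or> b = 0")
  case False
  then have n: "0 < norm y" "0 < b" using b by auto
  have "norm ((b * norm y powr (\<alpha> - 2)) *\<^sub>R y) = b * norm y powr (\<alpha> - 1)"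
    using n powr_add[of "norm y" "\<alpha> - 2" 1] by (simp add: algebra_simps)
  then have "norm ((b * norm y powr (\<alpha> - 2)) *\<^sub>R y) powr (p - 2) = b powr (p - 2) * norm y powr ((\<alpha> - 1) * (p - 2))"
    using n by (simp add: powr_mult powr_powr del: norm_scaleR)
  moreover have "b powr (p - 2) * b = b powr (p - 1)"
    using n powr_add[of b "p - 2" 1] by (simp add: algebra_simps)
  moreover have "norm y powr ((\<alpha> - 1) * (p - 2)) * norm y powr (\<alpha> - 2) = norm y powr (\<alpha> * q)"
  proof -
    have "(\<alpha> - 1) * (p - 2) + (\<alpha> - 2) = \<alpha> * q" using \<alpha> by (simp add: algebra_simps)
    then show ?thesis by (simp flip: powr_add)
  qed
  moreover have "radial_weight (\<alpha> * q) y = norm y powr (\<alpha> * q)"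
    using n by (simp add: radial_weight_def)
  ultimately show ?thesis
    by (metis (no_types, lifting) mult.assoc mult.left_commute scaleR_scaleR)
qed auto

text \<open>
  Suppose that \<open>u\<close> is below the barrier \<open>v\<close> on the whole sphere. The test function \<open>\<phi>\<close> of
  \<open>weak_solution_approximate_comparison\<close>, together with the integration by parts for the flux
  of \<open>v\<close>, shows that the integral of \<open>(lam * u powr q - c1 * k) * \<phi>\<close> is at most a given error,
  where \<open>c1 * k\<close> is the \<open>p\<close>-Laplacian of \<open>v\<close>. Where \<open>v \<le> u\<close> the first factor is at least
  \<open>l0 / 2 * u powr q\<close>, and near \<open>a\<close> this contributes a fixed positive amount \<open>\<kappa>\<close>. Where \<open>u < v\<close>
  the test function is at most \<open>\<sigma>\<^sup>2\<close>, so the loss is negligible.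
\<close>

lemma weak_solution_nondegenerate:
  fixes \<Omega> :: "'a::euclidean_space set" and p q \<alpha> c r l0 l1 :: real
  assumes \<Omega>: "open \<Omega>" and lam: "lam \<in> borel_measurable (lebesgue_on \<Omega>)"
    and lam_low: "\<And>x. x \<in> \<Omega> \<Longrightarrow> l0 \<le> lam x" and lam_up: "\<And>x. x \<in> \<Omega> \<Longrightarrow> lam x \<le> l1" and l0: "0 < l0"
    and p: "2 \<le> p" and q: "0 \<le> q" "q < p - 1"
    and sol: "weak_solution p q lam g \<Omega> u" and u0: "\<And>x. x \<in> \<Omega> \<Longrightarrow> 0 \<le> u x"
    and B: "cball a r \<subseteq> \<Omega>" and r: "0 < r" and ua: "0 < u a"
    and \<alpha>: "\<alpha> = p / (p - 1 - q)" and c: "0 < c"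
    and super: "(c * \<alpha>) powr (p - 1) * (DIM('a) + \<alpha> * q) \<le> l0 / 2 * c powr q"
  shows "\<exists>x \<in> sphere a r. c * r powr \<alpha> \<le> u x"
proof (rule ccontr)
  assume neg: "\<not> (\<exists>x \<in> sphere a r. c * r powr \<alpha> \<le> u x)"
  have \<alpha>1: "1 < \<alpha>" and \<alpha>p: "\<alpha> * (p - 1 - q) = p" using q by (auto simp: \<alpha> field_simps)
  define m where "m = \<alpha> * q"
  have m: "0 \<le> m" using \<alpha>1 q by (simp add: m_def)
  define k where "k = (\<lambda>x. radial_weight m (x - a))"
  define c1 where "c1 = (c * \<alpha>) powr (p - 1) * (DIM('a) + m)"
  have c1: "0 \<le> c1" "c1 \<le> l0 / 2 * c powr q" using super m by (auto simp: c1_def m_def)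
  define v where "v = (\<lambda>x. c * norm (x - a) powr \<alpha>)"
  define Dv where "Dv = (\<lambda>x. (c * \<alpha> * norm (x - a) powr (\<alpha> - 2)) *\<^sub>R (x - a))"
  have gradv: "GDERIV v x :> Dv x" for x
  proof -
    have "((\<lambda>x. norm (x - a) powr \<alpha>) has_derivative (\<lambda>h. h \<bullet> ((\<alpha> * norm (x - a) powr (\<alpha> - 2)) *\<^sub>R (x - a)))) (at x)"
      using GDERIV_norm_powr[OF \<alpha>1, of "x - a"] unfolding gderiv_def
      by (rule has_derivative_compose[rotated]) (auto intro!: derivative_eq_intros)
    from has_derivative_mult_right[OF this, of c] show ?thesis
      by (simp add: gderiv_def v_def Dv_def mult_ac)
  qed
  have contDv: "continuous_on UNIV Dv"
  proof -
    have "continuous_on UNIV (\<lambda>x. norm (x - a) powr (\<alpha> - 2) *\<^sub>R (x - a))"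
      by (rule continuous_on_compose2[OF continuous_norm_powr_scaleR, where f="\<lambda>x. x - a"])
         (use \<alpha>1 in \<open>auto intro!: continuous_intros\<close>)
    from continuous_on_scaleR[OF continuous_on_const this, of "c * \<alpha>"] show ?thesis
      by (simp add: Dv_def)
  qed
  have contu: "continuous_on (cball a r) u" and contu\<Omega>: "continuous_on \<Omega> u"
    using sol B closure_subset[of \<Omega>] by (auto simp: weak_solution_def intro: continuous_on_subset)
  have contv: "continuous_on UNIV v" using gradv by (rule GDERIV_continuous_on)
  have contk: "continuous_on UNIV k"
    unfolding k_def using continuous_radial_weight[OF m]
    by (rule continuous_on_compose2) (auto intro!: continuous_intros)
  have k0: "0 \<le> k x" for x by (simp add: k_def radial_weight_nonneg)
  have less: "u x < v x" if "x \<in> sphere a r" for x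
  proof -
    have "norm (x - a) = r" using that by (simp add: dist_norm norm_minus_commute)
    then show ?thesis using neg that by (force simp: v_def not_le)
  qed
  have va: "v a = 0" by (simp add: v_def)
  \<comment> \<open>The centre is special: there \<open>v\<close> vanishes, and for \<open>q = 0\<close> the weight \<open>k\<close> is \<open>1\<close> while
     \<open>v powr q\<close> is \<open>0\<close>. The claim survives because \<open>u\<close> is positive at the centre.\<close>
  have above: "0 < u x" "c1 * k x \<le> l0 / 2 * u x powr q" if "x \<in> \<Omega>" "v x \<le> u x" for x
  proof -
    show ux: "0 < u x"
    proof (cases "x = a")
      case False
      then have "0 < v x" using c by (simp add: v_def)
      then show ?thesis using that by simp
    qed (simp add: ua)
    show "c1 * k x \<le> l0 / 2 * u x powr q"
    proof (cases "x = a")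
      case False
      then have "k x = norm (x - a) powr m" by (simp add: k_def radial_weight_def)
      then have "c1 * k x \<le> l0 / 2 * c powr q * norm (x - a) powr m"
        using mult_right_mono[OF c1(2), of "norm (x - a) powr m"] by simp
      also have "\<dots> = l0 / 2 * v x powr q"
        using c False by (simp add: v_def powr_mult powr_powr m_def)
      also have "\<dots> \<le> l0 / 2 * u x powr q"
        using that l0 q c by (intro mult_left_mono powr_mono2) (auto simp: v_def)
      finally show ?thesis .
    next
      case True
      show ?thesis
      proof (cases "m = 0")
        case True
        then have "q = 0" using \<alpha>1 by (simp add: m_def)
        then show ?thesis using True c1(2) c ux by (simp add: k_def radial_weight_def)
      next
        case False
        then show ?thesis using True l0 by (simp add: k_def radial_weight_def)
      qed
    qed
  qed
  \<comment> \<open>\<open>\<kappa>\<close> is the gain from the ball of radius \<open>\<rho>\<close>, where \<open>u - v\<close> is at least \<open>m0\<close>; \<open>\<sigma>\<close> makes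
     the loss at most \<open>\<kappa> / 4\<close>, and the comparison is applied with error \<open>\<kappa> / 4\<close>.\<close>
  define m0 where "m0 = u a / 2"
  have m0: "0 < m0" using ua by (simp add: m0_def)
  obtain \<rho> where \<rho>: "0 < \<rho>" "\<rho> \<le> r" "\<And>x. x \<in> ball a \<rho> \<Longrightarrow> m0 \<le> u x - v x"
  proof -
    have "continuous_on (cball a r) (\<lambda>x. u x - v x)"
      using contu continuous_on_subset[OF contv] by (intro continuous_on_diff) auto
    then obtain d where d: "0 < d" "\<And>x. x \<in> cball a r \<Longrightarrow> dist x a < d \<Longrightarrow> dist (u x - v x) (u a - v a) < m0"
      using m0 r unfolding continuous_on_iff by (metis centre_in_cball less_imp_le)
    show ?thesis
    proof (rule that[of "min d r"])
      fix x assume "x \<in> ball a (min d r)"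
      then have "dist (u x - v x) (u a - v a) < m0" by (intro d(2)) (auto simp: dist_commute)
      moreover have "u a = 2 * m0" by (simp add: m0_def)
      ultimately show "m0 \<le> u x - v x" using va by (auto simp: dist_real_def abs_less_iff)
    qed (use d r in auto)
  qed
  define vol where "vol = measure lborel (ball a r)"
  define vol0 where "vol0 = measure lborel (ball a \<rho>)"
  have vol: "0 \<le> vol" "0 < vol0"
    using content_ball_pos[OF \<rho>(1), of a] by (auto simp: vol_def vol0_def)
  obtain M1 where M1: "\<And>x. x \<in> cball a r \<Longrightarrow> k x \<le> M1"
  proof -
    have "bounded (k ` cball a r)"
      using continuous_on_subset[OF contk] by (intro compact_imp_bounded compact_continuous_image) auto
    then obtain b where "\<And>x. x \<in> cball a r \<Longrightarrow> norm (k x) \<le> b" unfolding bounded_pos by blast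
    then show ?thesis using that[of b] by force
  qed
  define M where "M = c1 * M1"
  have M: "0 \<le> M" "\<And>x. x \<in> cball a r \<Longrightarrow> c1 * k x \<le> M"
  proof -
    have "0 \<le> M1" using M1[of a] k0[of a] r by simp
    then show "0 \<le> M" using c1(1) by (simp add: M_def)
    show "c1 * k x \<le> M" if "x \<in> cball a r" for x
      unfolding M_def by (rule mult_left_mono[OF M1[OF that] c1(1)])
  qed
  define \<kappa>0 where "\<kappa>0 = l0 / 2 * m0 powr q * (m0 / 2)\<^sup>2"
  have \<kappa>0: "0 < \<kappa>0" using l0 m0 by (simp add: \<kappa>0_def)
  define \<kappa> where "\<kappa> = \<kappa>0 * vol0"
  have \<kappa>: "0 < \<kappa>" using \<kappa>0 vol by (simp add: \<kappa>_def)
  define \<sigma> where "\<sigma> = min 1 (min (m0 / 2) (\<kappa> / (4 * (M * vol + 1))))"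
  have Mv: "0 \<le> M * vol" using M vol by simp
  have \<sigma>: "0 < \<sigma>" "\<sigma> \<le> 1" using m0 \<kappa> Mv by (auto simp: \<sigma>_def)
  have \<sigma>m: "\<sigma> \<le> m0 / 2" unfolding \<sigma>_def by (rule order_trans[OF min.cobounded2 min.cobounded1])
  have \<sigma>M: "M * \<sigma>\<^sup>2 * vol \<le> \<kappa> / 4"
  proof -
    have "M * \<sigma>\<^sup>2 * vol = (M * vol) * \<sigma>\<^sup>2" by simp
    also have "\<dots> \<le> (M * vol) * \<sigma>"
      using \<sigma> Mv by (intro mult_left_mono) (auto simp: power2_eq_square mult_left_le)
    also have "\<dots> \<le> (M * vol) * (\<kappa> / (4 * (M * vol + 1)))"
      using Mv by (intro mult_left_mono) (auto simp: \<sigma>_def)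
    also have "\<dots> \<le> \<kappa> / 4" using Mv \<kappa> by (simp add: field_simps)
    finally show ?thesis .
  qed
  obtain ue \<phi> D\<phi> where ue: "\<And>x. x \<in> cball a r \<Longrightarrow> \<bar>ue x - u x\<bar> \<le> \<sigma>" and C01: "C01 \<Omega> \<phi> D\<phi>"
    and \<phi>: "\<And>x. \<phi> x = (if x \<in> ball a r then (max (ue x - v x) 0)\<^sup>2 else 0)"
    and ineq: "(\<integral>x. (norm (Dv x) powr (p - 2) *\<^sub>R Dv x) \<bullet> D\<phi> x \<partial>lborel)
       + (\<integral>x. lam x * max (u x) 0 powr q * \<phi> x \<partial>lebesgue_on \<Omega>) \<le> \<kappa> / 4"
    using weak_solution_approximate_comparison[OF \<Omega> p sol B r gradv contDv less \<sigma>(1), of "\<kappa> / 4"] \<kappa> by auto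
  have grad\<phi>: "GDERIV \<phi> x :> D\<phi> x" for x using C01 by (simp add: C01_def)
  have cont\<phi>: "continuous_on UNIV \<phi>" using grad\<phi> by (rule GDERIV_continuous_on)
  have \<phi>0: "0 \<le> \<phi> x" for x by (simp add: \<phi>)
  have \<phi>out: "\<phi> x = 0" if "x \<notin> ball a r" for x using that by (simp add: \<phi>)
  have supp: "{x. \<phi> x \<noteq> 0} \<subseteq> ball a r" using \<phi>out by blast
  have flux: "norm (Dv x) powr (p - 2) *\<^sub>R Dv x = ((c * \<alpha>) powr (p - 1) * k x) *\<^sub>R (x - a)" for x
    using barrier_flux[OF \<alpha>p, of "c * \<alpha>" "x - a"] c \<alpha>1 by (simp add: Dv_def k_def m_def)
  have "(\<integral>x. (norm (Dv x) powr (p - 2) *\<^sub>R Dv x) \<bullet> D\<phi> x \<partial>lborel)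
     = (\<integral>x. (c * \<alpha>) powr (p - 1) * (radial_weight m (x - a) * ((x - a) \<bullet> D\<phi> x)) \<partial>lborel)"
    by (simp only: flux) (simp add: k_def mult.assoc)
  also have "\<dots> = (c * \<alpha>) powr (p - 1) * (\<integral>x. radial_weight m (x - a) * ((x - a) \<bullet> D\<phi> x) \<partial>lborel)"
    by simp
  also have "\<dots> = (c * \<alpha>) powr (p - 1) * (- (DIM('a) + m) * (\<integral>x. radial_weight m (x - a) * \<phi> x \<partial>lborel))"
    using C01 supp bounded_subset[OF bounded_ball supp]
    by (subst homogeneous_field_divergence_theorem[OF grad\<phi> _ _ continuous_radial_weight[OF m] radial_weight_scaleR])
       (auto simp: C01_def)
  also have "\<dots> = - (c1 * (\<integral>x. k x * \<phi> x \<partial>lborel))"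
    by (simp add: c1_def k_def algebra_simps)
  finally have I2: "(\<integral>x. (norm (Dv x) powr (p - 2) *\<^sub>R Dv x) \<bullet> D\<phi> x \<partial>lborel) = - (c1 * (\<integral>x. k x * \<phi> x \<partial>lborel))" .
  have bk: "bounded {x. k x * \<phi> x \<noteq> 0}"
    using supp by (intro bounded_subset[OF bounded_ball[of a r]]) auto
  have contk\<phi>: "continuous_on UNIV (\<lambda>x. k x * \<phi> x)"
    using contk cont\<phi> by (intro continuous_on_mult)
  have ik: "integrable (lebesgue_on \<Omega>) (\<lambda>x. k x * \<phi> x)"
    using integrable_lebesgue_on[OF \<Omega> integrable_lborel_continuous_support[OF contk\<phi> bk]] .
  have ek: "(\<integral>x. k x * \<phi> x \<partial>lebesgue_on \<Omega>) = (\<integral>x. k x * \<phi> x \<partial>lborel)"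
  proof (rule integral_lebesgue_on_eq_lborel[OF \<Omega>])
    show "(\<lambda>x. k x * \<phi> x) \<in> borel_measurable borel" using contk\<phi> by (rule borel_measurable_continuous_onI)
    show "k x * \<phi> x = 0" if "x \<notin> \<Omega>" for x
    proof -
      have "x \<notin> ball a r" using that B ball_subset_cball by blast
      then show ?thesis by (simp add: \<phi>out)
    qed
  qed
  obtain Bu where Bu: "\<And>x. x \<in> cball a r \<Longrightarrow> u x \<le> Bu"
  proof -
    have "bounded (u ` cball a r)"
      using contu by (intro compact_imp_bounded compact_continuous_image) auto
    then obtain b where "\<And>x. x \<in> cball a r \<Longrightarrow> norm (u x) \<le> b" unfolding bounded_pos by blast
    then show ?thesis using that[of b] by force
  qed
  have iball: "integrable lborel (indicator (ball a s) :: 'a \<Rightarrow> real)" for s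
    using emeasure_bounded_finite[of "ball a s"] by (intro integrable_real_indicator) auto
  have il: "integrable (lebesgue_on \<Omega>) (\<lambda>x. lam x * max (u x) 0 powr q * \<phi> x)"
  proof (rule Bochner_Integration.integrable_bound)
    have "bounded {x. \<phi> x \<noteq> 0}" using supp bounded_ball bounded_subset by blast
    then show "integrable (lebesgue_on \<Omega>) (\<lambda>x. (l1 * Bu powr q) * \<phi> x)"
      using integrable_lebesgue_on[OF \<Omega> integrable_lborel_continuous_support[OF cont\<phi>]] by simp
    have [measurable]: "u \<in> borel_measurable (lebesgue_on \<Omega>)" "\<phi> \<in> borel_measurable (lebesgue_on \<Omega>)"
      using \<Omega> contu\<Omega> continuous_on_subset[OF cont\<phi>]
      by (auto intro!: continuous_imp_measurable_on_sets_lebesgue)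
    show "(\<lambda>x. lam x * max (u x) 0 powr q * \<phi> x) \<in> borel_measurable (lebesgue_on \<Omega>)"
      using lam by measurable
    show "AE x in lebesgue_on \<Omega>. norm (lam x * max (u x) 0 powr q * \<phi> x) \<le> norm ((l1 * Bu powr q) * \<phi> x)"
    proof (rule AE_I2)
      fix x assume "x \<in> space (lebesgue_on \<Omega>)"
      then have x: "x \<in> \<Omega>" by simp
      show "norm (lam x * max (u x) 0 powr q * \<phi> x) \<le> norm ((l1 * Bu powr q) * \<phi> x)"
      proof (cases "x \<in> ball a r")
        case True
        have "lam x * max (u x) 0 powr q * \<phi> x \<le> (l1 * Bu powr q) * \<phi> x"
          using lam_low[OF x] lam_up[OF x] l0 u0[OF x] Bu[of x] True \<phi>0 q
          by (intro mult_right_mono mult_mono powr_mono2) auto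
        moreover have "0 \<le> lam x * max (u x) 0 powr q * \<phi> x"
          using lam_low[OF x] l0 \<phi>0 by simp
        ultimately show ?thesis by simp
      qed (simp add: \<phi>out)
    qed
  qed
  have pw: "\<kappa>0 * indicator (ball a \<rho>) x - M * \<sigma>\<^sup>2 * indicator (ball a r) x
      \<le> lam x * max (u x) 0 powr q * \<phi> x - c1 * (k x * \<phi> x)" if x: "x \<in> \<Omega>" for x
  proof (cases "x \<in> ball a r")
    case False
    then have "x \<notin> ball a \<rho>" using \<rho>(2) by auto
    then show ?thesis using False \<phi>out by simp
  next
    case True
    then have xc: "x \<in> cball a r" by simp
    have factor: "lam x * max (u x) 0 powr q * \<phi> x - c1 * (k x * \<phi> x) = (lam x * u x powr q - c1 * k x) * \<phi> x"
      using u0[OF x] by (simp add: algebra_simps max_def)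
    show ?thesis
    proof (cases "v x \<le> u x")
      case True
      have "l0 * u x powr q \<le> lam x * u x powr q" using lam_low[OF x] by (intro mult_right_mono) auto
      then have low: "l0 / 2 * u x powr q \<le> lam x * u x powr q - c1 * k x"
        using above(2)[OF x True] by simp
      have "\<kappa>0 * indicator (ball a \<rho>) x \<le> (lam x * u x powr q - c1 * k x) * \<phi> x"
      proof (cases "x \<in> ball a \<rho>")
        case True
        have "m0 \<le> u x - v x" by (rule \<rho>(3)[OF True])
        moreover have "0 \<le> v x" using c by (simp add: v_def)
        ultimately have "m0 \<le> u x" "m0 / 2 \<le> ue x - v x" using ue[OF xc] \<sigma>m by (auto simp: abs_le_iff)
        then have "l0 / 2 * m0 powr q \<le> l0 / 2 * u x powr q" and "(m0 / 2)\<^sup>2 \<le> \<phi> x"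
          using m0 l0 q \<open>x \<in> ball a r\<close> by (auto simp: \<phi> intro!: mult_left_mono powr_mono2 power_mono)
        moreover have "0 \<le> l0 / 2 * u x powr q" using l0 by simp
        ultimately have "l0 / 2 * m0 powr q * (m0 / 2)\<^sup>2 \<le> (lam x * u x powr q - c1 * k x) * \<phi> x"
          using low by (intro mult_mono) (linarith | rule zero_le_power2)+
        then show ?thesis using True by (simp add: \<kappa>0_def)
      next
        case False
        have "0 \<le> l0 / 2 * u x powr q" using l0 by simp
        then have "0 \<le> lam x * u x powr q - c1 * k x" using low by linarith
        then show ?thesis using False \<phi>0[of x] by simp
      qed
      moreover have "0 \<le> M * \<sigma>\<^sup>2 * indicator (ball a r) x" using M(1) by simp
      ultimately show ?thesis unfolding factor by linarith
    next
      case False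
      then have "x \<notin> ball a \<rho>" using \<rho>(3)[of x] m0 by fastforce
      moreover have "\<phi> x \<le> \<sigma>\<^sup>2"
        using ue[OF xc] False \<sigma>(1) True by (auto simp: \<phi> abs_le_iff intro!: power_mono)
      moreover have "- M \<le> lam x * u x powr q - c1 * k x"
        using M(2)[OF xc] lam_low[OF x] l0 by (smt (verit) mult_nonneg_nonneg powr_ge_zero)
      then have "- M * \<phi> x \<le> (lam x * u x powr q - c1 * k x) * \<phi> x"
        using \<phi>0[of x] by (rule mult_right_mono)
      moreover have "M * \<phi> x \<le> M * \<sigma>\<^sup>2" using M(1) calculation(2) by (intro mult_left_mono)
      ultimately show ?thesis unfolding factor using True by simp
    qed
  qed
  let ?L = "\<lambda>x. \<kappa>0 * indicator (ball a \<rho>) x - M * \<sigma>\<^sup>2 * indicator (ball a r) x"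
  have "\<kappa> - M * \<sigma>\<^sup>2 * vol = (\<integral>x. ?L x \<partial>lborel)"
    using iball by (simp add: \<kappa>_def vol_def vol0_def)
  also have "\<dots> = (\<integral>x. ?L x \<partial>lebesgue_on \<Omega>)"
  proof (rule integral_lebesgue_on_eq_lborel[OF \<Omega>, symmetric])
    show "?L x = 0" if "x \<notin> \<Omega>" for x
      using that B \<rho>(2) by (force simp: indicator_def)
    show "?L \<in> borel_measurable borel"
      by (intro borel_measurable_diff borel_measurable_times borel_measurable_const borel_measurable_indicator)
         auto
  qed
  also have "\<dots> \<le> (\<integral>x. lam x * max (u x) 0 powr q * \<phi> x - c1 * (k x * \<phi> x) \<partial>lebesgue_on \<Omega>)"
  proof (rule integral_mono)
    have "integrable lborel ?L" using iball by (intro Bochner_Integration.integrable_diff integrable_mult_right) auto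
    then show "integrable (lebesgue_on \<Omega>) ?L" by (rule integrable_lebesgue_on[OF \<Omega>])
  qed (use il ik pw in auto)
  also have "\<dots> = (\<integral>x. lam x * max (u x) 0 powr q * \<phi> x \<partial>lebesgue_on \<Omega>) - c1 * (\<integral>x. k x * \<phi> x \<partial>lborel)"
    using il ik ek by simp
  also have "\<dots> \<le> \<kappa> / 4" using ineq I2 by simp
  finally show False using \<sigma>M \<kappa> by simp
qed

section \<open>The limit of large exponents\<close>

definition barrier_exponent :: "real \<Rightarrow> real \<Rightarrow> real" where
  "barrier_exponent p q = p / (p - 1 - q)"

text \<open>
  The factor \<open>c\<close> for which \<open>c * norm y powr \<alpha>\<close> solves the equation in dimension \<open>n\<close> with
  the constant coefficient \<open>l0 / 2\<close>; see \<open>barrier_constant_supersolution\<close>.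
\<close>

definition barrier_constant :: "real \<Rightarrow> real \<Rightarrow> real \<Rightarrow> real \<Rightarrow> real" where
  "barrier_constant n l0 p q = (l0 / 2 / (barrier_exponent p q powr (p - 1) * (n + barrier_exponent p q * q))) powr (1 / (p - 1 - q))"

lemma barrier_constant_pos:
  assumes "1 \<le> n" "0 < l0" "0 \<le> q" "q < p - 1"
  shows "0 < barrier_constant n l0 p q"
proof -
  have "0 < barrier_exponent p q" using assms by (simp add: barrier_exponent_def)
  moreover then have "0 < n + barrier_exponent p q * q" using assms by (simp add: add_pos_nonneg)
  ultimately show ?thesis using assms by (simp add: barrier_constant_def)
qed

lemma barrier_constant_supersolution:
  assumes "1 \<le> n" "0 < l0" "0 \<le> q" "q < p - 1"
  shows "(barrier_constant n l0 p q * barrier_exponent p q) powr (p - 1) * (n + barrier_exponent p q * q)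
    = l0 / 2 * barrier_constant n l0 p q powr q"
proof -
  define \<alpha> where "\<alpha> = barrier_exponent p q"
  define c where "c = barrier_constant n l0 p q"
  have \<alpha>: "0 < \<alpha>" using assms by (simp add: \<alpha>_def barrier_exponent_def)
  have nq: "0 < n + \<alpha> * q" using assms \<alpha> by (simp add: add_pos_nonneg)
  have c: "0 < c" using barrier_constant_pos[OF assms] by (simp add: c_def)
  have "c powr (p - 1 - q) = l0 / 2 / (\<alpha> powr (p - 1) * (n + \<alpha> * q))"
    using assms \<alpha> nq by (simp add: c_def barrier_constant_def powr_powr flip: \<alpha>_def)
  then have "c powr (p - 1 - q) * (\<alpha> powr (p - 1) * (n + \<alpha> * q)) = l0 / 2"
    using \<alpha> nq by simp
  moreover have "c powr (p - 1) = c powr (p - 1 - q) * c powr q" by (simp flip: powr_add)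
  ultimately have "(c * \<alpha>) powr (p - 1) * (n + \<alpha> * q) = l0 / 2 * c powr q"
    using c \<alpha> by (simp add: powr_mult mult_ac)
  then show ?thesis by (simp add: c_def \<alpha>_def)
qed

text \<open>
  The logarithm of the barrier constant is a quotient with denominator
  \<open>p - 1 - q\<close>, of order \<open>(1 - l) * p\<close>. In the numerator only the term \<open>(p - 1) * ln \<alpha>\<close> grows
  linearly; the coefficient contributes a constant and the dimensional factor
  \<open>n + \<alpha> * q\<close> at most a logarithm of \<open>p\<close>.
\<close>

lemma barrier_limits:
  fixes p q :: "nat \<Rightarrow> real"
  assumes n: "1 \<le> n" and l0: "0 < l0" and p: "\<And>j. 2 \<le> p j" and q: "\<And>j. 0 \<le> q j" "\<And>j. q j < p j - 1"
    and pinf: "filterlim p at_top sequentially" and lim: "(\<lambda>j. q j / p j) \<longlonglongrightarrow> l" and l: "l < 1"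
  shows "(\<lambda>j. barrier_exponent (p j) (q j)) \<longlonglongrightarrow> 1 / (1 - l)"
    and "(\<lambda>j. barrier_constant n l0 (p j) (q j)) \<longlonglongrightarrow> (1 - l) powr (1 / (1 - l))"
proof -
  define \<alpha> where "\<alpha> = (\<lambda>j. barrier_exponent (p j) (q j))"
  define d where "d = (\<lambda>j. (p j - 1 - q j) / p j)"
  have p0: "0 < p j" "p j \<noteq> 0" for j using p[of j] by auto
  have inv0: "(\<lambda>j. 1 / p j) \<longlonglongrightarrow> 0"
    using tendsto_inverse_0_at_top[OF pinf] by (simp add: inverse_eq_divide)
  have dlim: "d \<longlonglongrightarrow> 1 - l"
  proof -
    have "d = (\<lambda>j. 1 - 1 / p j - q j / p j)" using p0 by (auto simp: d_def diff_divide_distrib)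
    then show ?thesis using tendsto_diff[OF tendsto_diff[OF tendsto_const[of 1] inv0] lim] by simp
  qed
  have d0: "0 < d j" for j using q(2)[of j] p0[of j] by (simp add: d_def)
  have \<alpha>d: "\<alpha> j = 1 / d j" for j by (simp add: \<alpha>_def d_def barrier_exponent_def)
  have \<alpha>lim: "\<alpha> \<longlonglongrightarrow> 1 / (1 - l)"
    unfolding \<alpha>d[abs_def] using dlim l by (intro tendsto_intros) auto
  then show "(\<lambda>j. barrier_exponent (p j) (q j)) \<longlonglongrightarrow> 1 / (1 - l)" by (simp add: \<alpha>_def)
  have \<alpha>0: "0 < \<alpha> j" for j using d0[of j] by (simp add: \<alpha>d)
  define s where "s = (\<lambda>j. n + \<alpha> j * q j)"
  have s1: "1 \<le> s j" for j using n \<alpha>0[of j] q(1)[of j] by (simp add: s_def add_increasing2)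
  have lnp: "(\<lambda>j. ln (p j) / p j) \<longlonglongrightarrow> 0"
    using filterlim_compose[OF ln_x_over_x_tendsto_0 pinf] .
  have lns: "(\<lambda>j. ln (s j) / p j) \<longlonglongrightarrow> 0"
  proof (rule tendsto_sandwich)
    show "\<forall>\<^sub>F j in sequentially. 0 \<le> ln (s j) / p j" using s1 p0 by (auto simp: less_imp_le)
    show "\<forall>\<^sub>F j in sequentially. ln (s j) / p j \<le> ln (p j) / p j + ln (n + \<alpha> j) * (1 / p j)"
    proof (rule always_eventually, rule allI)
      fix j
      have "s j \<le> p j * (n + \<alpha> j)"
      proof -
        have "n * 1 \<le> n * p j" using n p[of j] by (intro mult_left_mono) auto
        moreover have "\<alpha> j * q j \<le> \<alpha> j * p j" using \<alpha>0[of j] q(2)[of j] by (intro mult_left_mono) auto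
        ultimately show ?thesis by (simp add: s_def algebra_simps)
      qed
      then have "ln (s j) \<le> ln (p j * (n + \<alpha> j))" using s1[of j] by (intro ln_mono) auto
      also have "\<dots> = ln (p j) + ln (n + \<alpha> j)" using p0[of j] n \<alpha>0[of j] by (intro ln_mult_pos) auto
      finally have "ln (s j) / p j \<le> (ln (p j) + ln (n + \<alpha> j)) / p j" using p0[of j] by (intro divide_right_mono) auto
      then show "ln (s j) / p j \<le> ln (p j) / p j + ln (n + \<alpha> j) * (1 / p j)" by (simp add: add_divide_distrib)
    qed
    have "0 < n + 1 / (1 - l)" using n l by (simp add: add_pos_pos)
    then have "(\<lambda>j. ln (n + \<alpha> j)) \<longlonglongrightarrow> ln (n + 1 / (1 - l))"
      using \<alpha>lim by (intro tendsto_intros) auto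
    from tendsto_add[OF lnp tendsto_mult[OF this inv0]]
    show "(\<lambda>j. ln (p j) / p j + ln (n + \<alpha> j) * (1 / p j)) \<longlonglongrightarrow> 0" by simp
  qed simp
  define L where "L = (\<lambda>j. (ln (l0 / 2) * (1 / p j) - (1 - 1 / p j) * ln (\<alpha> j) - ln (s j) / p j) / d j)"
  have ln\<alpha>: "(\<lambda>j. ln (\<alpha> j)) \<longlonglongrightarrow> ln (1 / (1 - l))" using \<alpha>lim l by (intro tendsto_ln) auto
  have "L \<longlonglongrightarrow> (ln (l0 / 2) * 0 - (1 - 0) * ln (1 / (1 - l)) - 0) / (1 - l)"
    unfolding L_def using l
    by (intro tendsto_divide tendsto_diff tendsto_mult tendsto_const inv0 lns ln\<alpha> dlim) auto
  then have "L \<longlonglongrightarrow> 1 / (1 - l) * ln (1 - l)" using l by (simp add: ln_div)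
  then have "(\<lambda>j. exp (L j)) \<longlonglongrightarrow> exp (1 / (1 - l) * ln (1 - l))" by (rule tendsto_exp)
  moreover have "barrier_constant n l0 (p j) (q j) = exp (L j)" for j
  proof -
    have pos: "0 < l0 / 2" "0 < \<alpha> j powr (p j - 1)" "0 < s j" using l0 \<alpha>0[of j] s1[of j] by auto
    have "barrier_constant n l0 (p j) (q j) = (l0 / 2 / (\<alpha> j powr (p j - 1) * s j)) powr (1 / (p j - 1 - q j))"
      by (simp add: barrier_constant_def \<alpha>_def s_def)
    also have "\<dots> = exp (1 / (p j - 1 - q j) * ln (l0 / 2 / (\<alpha> j powr (p j - 1) * s j)))"
      using l0 \<alpha>0[of j] s1[of j] by (simp add: powr_def)
    also have "ln (l0 / 2 / (\<alpha> j powr (p j - 1) * s j)) = ln (l0 / 2) - ((p j - 1) * ln (\<alpha> j) + ln (s j))"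
      using pos \<alpha>0[of j] by (simp add: ln_div ln_mult ln_powr)
    also have "1 / (p j - 1 - q j) * (ln (l0 / 2) - ((p j - 1) * ln (\<alpha> j) + ln (s j))) = L j"
      using p0[of j] q(2)[of j] by (simp add: L_def d_def field_simps)
    finally show ?thesis .
  qed
  ultimately show "(\<lambda>j. barrier_constant n l0 (p j) (q j)) \<longlonglongrightarrow> (1 - l) powr (1 / (1 - l))"
    using l by (simp add: powr_def)
qed

text \<open>
  The estimate for finite exponents is applied at points \<open>x1\<close> near \<open>x0\<close> with \<open>uinf x1 > 0\<close> and
  with radii \<open>s < r\<close>, so that the sphere about \<open>x1\<close> stays in the ball of radius \<open>r\<close> about \<open>x0\<close>;
  first the index tends to infinity, then \<open>s\<close> to \<open>r\<close>.
\<close>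

theorem theorem1p5:
  fixes \<Omega> \<Omega>' :: "'a::euclidean_space set"
    and lam g uinf :: "'a \<Rightarrow> real"
    and q :: "real \<Rightarrow> real"
    and u :: "real \<Rightarrow> 'a \<Rightarrow> real"
    and p :: "nat \<Rightarrow> real"
    and l :: real
  assumes "regular_bounded_domain \<Omega>"
    and "lam \<in> borel_measurable (lebesgue_on \<Omega>)"
    and "bounded (lam ` \<Omega>)"
    and "0 < (INF x\<in>\<Omega>. lam x)"
    and "\<exists>L. L-lipschitz_on (frontier \<Omega>) g"
    and "\<forall>x \<in> frontier \<Omega>. 0 \<le> g x"
    and "\<forall>s \<ge> 2. 0 \<le> q s \<and> q s < s - 1"
    and "((\<lambda>s. q s / s) \<longlongrightarrow> l) at_top"
    and "0 \<le> l" and "l < 1"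
    and "\<forall>j. 2 \<le> p j"
    and "filterlim p at_top sequentially"
    and "\<forall>j. weak_solution (p j) (q (p j)) lam g \<Omega> (u (p j))"
    and "\<forall>j. \<forall>x \<in> closure \<Omega>. 0 \<le> u (p j) x"
    and "uniform_limit (closure \<Omega>) (\<lambda>j. u (p j)) uinf sequentially"
    and "\<Omega>' \<Subset> \<Omega>"
  shows "\<exists>r0 > 0. \<forall>x0 \<in> frontier {x \<in> \<Omega>. uinf x > 0} \<inter> \<Omega>'. \<forall>r. 0 < r \<and> r < r0 \<longrightarrow>
    (SUP x \<in> ball x0 r. uinf x) \<ge> (1 - l) powr (1 / (1 - l)) * r powr (1 / (1 - l))"
proof -
  have \<Omega>: "open \<Omega>" "bounded \<Omega>"
    using assms(1) by (auto simp: regular_bounded_domain_def domain_def)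
  define l0 where "l0 = (INF x\<in>\<Omega>. lam x)"
  have l0: "0 < l0" using assms(4) by (simp add: l0_def)
  have lam_low: "l0 \<le> lam x" if "x \<in> \<Omega>" for x
    unfolding l0_def using assms(3) that by (intro cINF_lower bounded_imp_bdd_below)
  obtain l1 where lam_up: "\<And>x. x \<in> \<Omega> \<Longrightarrow> lam x \<le> l1"
  proof -
    obtain b where "\<And>x. x \<in> \<Omega> \<Longrightarrow> norm (lam x) \<le> b" using assms(3) unfolding bounded_pos by blast
    then show ?thesis using that[of b] by force
  qed
  have q: "0 \<le> q (p j)" "q (p j) < p j - 1" and p: "2 \<le> p j" for j using assms(7,11) by auto
  have sol: "weak_solution (p j) (q (p j)) lam g \<Omega> (u (p j))" for j using assms(13) by blast
  have unn: "0 \<le> u (p j) x" if "x \<in> \<Omega>" for j x using assms(14) that closure_subset by blast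
  define \<alpha> where "\<alpha> = (\<lambda>j. barrier_exponent (p j) (q (p j)))"
  define c where "c = (\<lambda>j. barrier_constant (DIM('a)) l0 (p j) (q (p j)))"
  define C where "C = (1 - l) powr (1 / (1 - l))"
  have N: "1 \<le> real DIM('a)" by (simp add: DIM_positive Suc_leI)
  have qlim: "(\<lambda>j. q (p j) / p j) \<longlonglongrightarrow> l" by (rule filterlim_compose[OF assms(8,12)])
  have \<alpha>lim: "\<alpha> \<longlonglongrightarrow> 1 / (1 - l)" and clim: "c \<longlonglongrightarrow> C"
    using barrier_limits[OF N l0 p q assms(12) qlim assms(10)] by (simp_all add: \<alpha>_def c_def C_def)
  have nondeg: "\<exists>x \<in> sphere a r. c j * r powr \<alpha> j \<le> u (p j) x"
    if "cball a r \<subseteq> \<Omega>" "0 < r" "0 < u (p j) a" for a r j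
  proof (rule weak_solution_nondegenerate[OF \<Omega>(1) assms(2) lam_low lam_up l0 p q sol unn that])
    show "\<alpha> j = p j / (p j - 1 - q (p j))" by (simp add: \<alpha>_def barrier_exponent_def)
    show "0 < c j" unfolding c_def by (rule barrier_constant_pos[OF N l0 q])
    show "(c j * \<alpha> j) powr (p j - 1) * (DIM('a) + \<alpha> j * q (p j)) \<le> l0 / 2 * c j powr q (p j)"
      using barrier_constant_supersolution[OF N l0 q] by (simp add: c_def \<alpha>_def)
  qed
  have "continuous_on (closure \<Omega>) uinf"
  proof (rule uniform_limit_theorem[OF _ assms(15)])
    show "\<forall>\<^sub>F j in sequentially. continuous_on (closure \<Omega>) (u (p j))"
      using sol by (auto simp: weak_solution_def)
  qed simp
  then have "bounded (uinf ` closure \<Omega>)"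
    using \<Omega>(2) by (intro compact_imp_bounded compact_continuous_image) (auto simp: compact_closure)
  then have bdd: "bdd_above (uinf ` B)" if "B \<subseteq> \<Omega>" for B
    using that closure_subset[of \<Omega>] by (intro bounded_imp_bdd_above) (meson bounded_subset image_mono subset_trans)
  obtain r0 where r0: "0 < r0" "(\<Union>x\<in>closure \<Omega>'. ball x r0) \<subseteq> \<Omega>"
    using compact_subset_open_imp_ball_epsilon_subset[of "closure \<Omega>'" \<Omega>] assms(16) \<Omega>(1)
    by (auto simp: compactly_contained_def)
  show ?thesis
  proof (intro exI[of _ r0] conjI ballI allI impI)
    fix x0 r assume x0: "x0 \<in> frontier {x \<in> \<Omega>. uinf x > 0} \<inter> \<Omega>'" and r: "0 < r \<and> r < r0"
    have B: "ball x0 r \<subseteq> \<Omega>"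
    proof -
      have "x0 \<in> closure \<Omega>'" using x0 closure_subset by blast
      then have "ball x0 r0 \<subseteq> \<Omega>" using r0(2) by blast
      then show ?thesis using r subset_ball[of r r0 x0] by simp
    qed
    define S where "S = (SUP x \<in> ball x0 r. uinf x)"
    have S: "uinf x \<le> S" if "x \<in> ball x0 r" for x
      unfolding S_def by (rule cSUP_upper[OF that bdd[OF B]])
    have inner: "C * s powr (1 / (1 - l)) \<le> S" if s: "0 < s" "s < r" for s
    proof (rule field_le_epsilon)
      fix e :: real assume e: "0 < e"
      have "x0 \<in> closure {x \<in> \<Omega>. uinf x > 0}" using x0 by (simp add: frontier_def)
      moreover have "0 < r - s" using s by simp
      ultimately have "\<exists>y\<in>{x \<in> \<Omega>. uinf x > 0}. dist y x0 < r - s"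
        using closure_approachable by blast
      then obtain x1 where x1: "x1 \<in> \<Omega>" "0 < uinf x1" "dist x1 x0 < r - s" by blast
      have B1: "cball x1 s \<subseteq> ball x0 r"
      proof
        fix y assume "y \<in> cball x1 s"
        then show "y \<in> ball x0 r" using x1(3) dist_triangle[of x0 y x1] by (simp add: dist_commute)
      qed
      have ev1: "\<forall>\<^sub>F j in sequentially. \<forall>x\<in>closure \<Omega>. dist (u (p j) x) (uinf x) < e"
        by (rule uniform_limitD[OF assms(15) e])
      have ev2: "\<forall>\<^sub>F j in sequentially. \<forall>x\<in>closure \<Omega>. dist (u (p j) x) (uinf x) < uinf x1"
        by (rule uniform_limitD[OF assms(15) x1(2)])
      have "\<forall>\<^sub>F j in sequentially. c j * s powr \<alpha> j \<le> S + e"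
        using ev1 ev2
      proof eventually_elim
        case (elim j)
        have "dist (u (p j) x1) (uinf x1) < uinf x1" using elim(2) x1(1) closure_subset by blast
        then have "0 < u (p j) x1" by (auto simp: dist_real_def abs_less_iff)
        then obtain x where x: "x \<in> sphere x1 s" "c j * s powr \<alpha> j \<le> u (p j) x"
          using nondeg[of x1 s j] B1 B s by blast
        have xb: "x \<in> ball x0 r" using x(1) B1 by auto
        then have "dist (u (p j) x) (uinf x) < e" using elim(1) B closure_subset by blast
        then have "u (p j) x < uinf x + e" by (auto simp: dist_real_def abs_less_iff)
        then show ?case using x(2) S[OF xb] by simp
      qed
      moreover have "(\<lambda>j. c j * s powr \<alpha> j) \<longlonglongrightarrow> C * s powr (1 / (1 - l))"
        using s by (intro tendsto_mult clim tendsto_powr tendsto_const \<alpha>lim) auto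
      ultimately show "C * s powr (1 / (1 - l)) \<le> S + e"
        by (intro tendsto_upperbound[of _ _ sequentially]) auto
    qed
    have "((\<lambda>s. C * s powr (1 / (1 - l))) \<longlongrightarrow> C * r powr (1 / (1 - l))) (at_left r)"
      using r by (intro tendsto_intros) auto
    moreover have "\<forall>\<^sub>F s in at_left r. C * s powr (1 / (1 - l)) \<le> S"
      using eventually_at_left_real[of 0 r] r by (auto elim!: eventually_mono intro: inner)
    ultimately have "C * r powr (1 / (1 - l)) \<le> S"
      by (rule tendsto_upperbound) simp
    then show "(1 - l) powr (1 / (1 - l)) * r powr (1 / (1 - l)) \<le> (SUP x \<in> ball x0 r. uinf x)"
      by (simp add: C_def S_def)
  qed (rule r0(1))
qed

end
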